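(* Let $\mathbf{U}\in\mathbb{U}$ be the exact solution of the stabilized mixed DG formulation, i.e. $\mathcal{B}^{\mathrm{DG}}_{\mathrm{stab}}(\mathbf{W};\mathbf{U})=\mathcal{L}^{\mathrm{DG}}_{\mathrm{stab}}(\mathbf{W})$ for all $\mathbf{W}\in\mathbb{U}$, and let $\mathbf{U}^h\in\mathbb{U}^h$ be the finite element solution, i.e. $\mathcal{B}^{\mathrm{DG}}_{\mathrm{stab}}(\mathbf{W}^h;\mathbf{U}^h)=\mathcal{L}^{\mathrm{DG}}_{\mathrm{stab}}(\mathbf{W}^h)$ for all $\mathbf{W}^h\in\mathbb{U}^h$. Then the error $\mathbf{E}:=\mathbf{U}^h-\mathbf{U}$ satisfies $$\mathcal{B}^{\mathrm{DG}}_{\mathrm{stab}}(\mathbf{W}^h;\mathbf{E})=0\qquad\forall\,\mathbf{W}^h\in\mathbb{U}^h\subset\mathbb{U}.$$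
   Context: **Domain and data.** $\Omega\subset\mathbb{R}^{nd}$ is an open bounded domain with smooth boundary and unit outward normal $\widehat{\mathbf{n}}$. For $i=1,2$ (the two pore-networks), $\partial\Omega=\Gamma_i^u\cup\Gamma_i^p$ with $\Gamma_i^u\cap\Gamma_i^p=\emptyset$; $u_{ni}$ is the prescribed normal velocity on $\Gamma_i^u$ and $p_{0i}$ the prescribed pressure on $\Gamma_i^p$. $\mu>0$ (viscosity), $\gamma>0$ (density), $\beta>0$ are constants; $\mathbf{b}_1,\mathbf{b}_2$ are specific body forces; the permeabilities $k_i(\mathbf{x})$ satisfy $0<\inf_\Omega \mu/k_i\le\sup_\Omega\mu/k_i<\infty$. $\eta_u,\eta_p\ge0$ are bounded constants. **Mesh.** $\mathcal{T}=\{\omega^1,\dots,\omega^{Nele}\}$ is a finite collection of disjoint open polyhedra (elements) with $\overline\Omega=\bigcup_i\overline{\omega}^i$; $\widetilde\Omega=\bigcup_i\omega^i$, and integrals over $\widetilde\Omega$ are sums of integrals over elements (derivatives are taken elementwise). "Edge" means node/edge/face in 1D/2D/3D; $\mathcal{E}^{\mathrm{int}}$ is the set of interior edges, $\Gamma^{\mathrm{int}}$ their union, and integrals over $\Gamma^{\mathrm{int}}$ are sums over $\Upsilon\in\mathcal{E}^{\mathrm{int}}$. $h_\omega$ is the element diameter (length of the largest edge of $\omega$). For $\Upsilon\in\mathcal{E}^{\mathrm{int}}$ shared by elements $\omega^\pm_\Upsilon$ with outward normals $\widehat{\mathbf{n}}^\pm_\Upsilon$, $h_\Upsilon=\frac12(h_{\omega^+_\Upsilon}+h_{\omega^-_\Upsilon})$.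 **Averages and jumps** on $\Upsilon\in\mathcal{E}^{\mathrm{int}}$ (superscripts $\pm$ denote traces from $\omega^\pm_\Upsilon$): for scalars $\{\!\!\{\varphi\}\!\!\}=\frac12(\varphi^++\varphi^-)$, $\llbracket\varphi\rrbracket=\varphi^+\widehat{\mathbf{n}}^++\varphi^-\widehat{\mathbf{n}}^-$ (a vector); for vectors $\{\!\!\{\boldsymbol\tau\}\!\!\}=\frac12(\boldsymbol\tau^++\boldsymbol\tau^-)$, $\llbracket\boldsymbol\tau\rrbracket=\boldsymbol\tau^+\cdot\widehat{\mathbf{n}}^++\boldsymbol\tau^-\cdot\widehat{\mathbf{n}}^-$ (a scalar). **Spaces.** $(\cdot;\cdot)_{\mathcal K}$ is the $L_2$ inner product over $\mathcal K$, the subscript being dropped when $\mathcal K=\widetilde\Omega$. $\mathcal{U}$ is the set of vector fields $\mathbf{u}$ with $\mathbf{u}|_{\omega^i}\in(L_2(\omega^i))^{nd}$, $\mathrm{div}[\mathbf{u}]\in L_2(\omega^i)$ for all $i$ (for the trace terms, velocity fields are assumed to be in $(H^1(\omega))^{nd}$ on each element). $\mathcal{Q}$ is the set of pairs $(p_1,p_2)$ with $p_j|_{\omega^i}\in H^1(\omega^i)$ for all $i$ and $(\int_{\widetilde\Omega}p_1\,d\Omega)(\int_{\widetilde\Omega}p_2\,d\Omega)=0$. $\mathbb{U}=\mathcal{U}\times\mathcal{U}\times\mathcal{Q}$. $\mathbb{U}^h=\mathcal{U}^h\times\mathcal{U}^h\times\mathcal{Q}^h\subset\mathbb{U}$, where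 $\mathcal{U}^h$ consists of the elements of $\mathcal{U}$ that on each $\overline\omega^i$ are continuous and polynomial of degree at most $k$ in each component, and $\mathcal{Q}^h$ of the pairs in $\mathcal{Q}$ both of whose members on each $\overline\omega^i$ are continuous and polynomial of degree at most $l$. The forms below are given by the same formulas for arbitrary elementwise fields of this regularity (no mean-value condition needed), so $\mathcal{B}^{\mathrm{DG}}_{\mathrm{stab}}(\cdot;\mathbf{E})$ makes sense for the difference $\mathbf{E}$. **Forms.** For $\mathbf{W}=(\mathbf{w}_1,\mathbf{w}_2,q_1,q_2)$, $\mathbf{U}=(\mathbf{u}_1,\mathbf{u}_2,p_1,p_2)$: $$\begin{aligned}\mathcal{B}^{\mathrm{DG}}_{\mathrm{stab}}(\mathbf{W};\mathbf{U})=\sum_{i=1}^2\Big[&(\mathbf{w}_i;\mu k_i^{-1}\mathbf{u}_i)-(\mathrm{div}[\mathbf{w}_i];p_i)+(q_i;\mathrm{div}[\mathbf{u}_i])+(\llbracket\mathbf{w}_i\rrbracket;\{\!\!\{p_i\}\!\!\})_{\Gamma^{\mathrm{int}}}-(\{\!\!\{q_i\}\!\!\};\llbracket\mathbf{u}_i\rrbracket)_{\Gamma^{\mathrm{int}}}\\&+(\mathbf{w}_i\cdot\widehat{\mathbf{n}};p_i)_{\Gamma_i^u}-(q_i;\mathbf{u}_i\cdot\widehat{\mathbf{n}})_{\Gamma_i^u}-\tfrac12\big(\mu k_i^{-1}\mathbf{w}_i-\mathrm{grad}[q_i];\mu^{-1}k_i(\mu k_i^{-1}\mathbf{u}_i+\mathrm{grad}[p_i])\big)\\&+(\eta_uh_\Upsilon\{\!\!\{\mu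 k_i^{-1}\}\!\!\}\llbracket\mathbf{w}_i\rrbracket;\llbracket\mathbf{u}_i\rrbracket)_{\Gamma^{\mathrm{int}}}+(\tfrac{\eta_p}{h_\Upsilon}\{\!\!\{\mu^{-1}k_i\}\!\!\}\llbracket q_i\rrbracket;\llbracket p_i\rrbracket)_{\Gamma^{\mathrm{int}}}\Big]+\big(q_1-q_2;\tfrac{\beta}{\mu}(p_1-p_2)\big),\end{aligned}$$ $$\mathcal{L}^{\mathrm{DG}}_{\mathrm{stab}}(\mathbf{W})=\sum_{i=1}^2\Big[(\mathbf{w}_i;\gamma\mathbf{b}_i)-(\mathbf{w}_i\cdot\widehat{\mathbf{n}};p_{0i})_{\Gamma_i^p}-(q_i;u_{ni})_{\Gamma_i^u}-\tfrac12\big(\mu k_i^{-1}\mathbf{w}_i-\mathrm{grad}[q_i];\mu^{-1}k_i\gamma\mathbf{b}_i\big)\Big].$$ *)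

theory Defs
  imports "HOL-Analysis.Analysis"
begin

section \<open>Weak derivatives on an open set\<close>

definition L2 :: "'a measure \<Rightarrow> ('a \<Rightarrow> 'b::euclidean_space) set" where
  "L2 M = {f. f \<in> borel_measurable M \<and> integrable M (\<lambda>x. (norm (f x))\<^sup>2)}"

text \<open>\<open>D bs\<close> is the iterated partial derivative of \<open>f\<close> in the basis directions listed in \<open>bs\<close>.\<close>

definition smooth :: "('a::euclidean_space \<Rightarrow> real) \<Rightarrow> bool" where
  "smooth f \<longleftrightarrow> (\<exists>D :: 'a list \<Rightarrow> 'a \<Rightarrow> real. D [] = f \<and>
     (\<forall>bs x. (D bs has_derivative (\<lambda>v. \<Sum>b\<in>Basis. (v \<bullet> b) * D (b # bs) x)) (at x)))"

definition test_fun :: "'a::euclidean_space set \<Rightarrow> ('a \<Rightarrow> real) \<Rightarrow> bool" where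
  "test_fun S \<psi> \<longleftrightarrow> smooth \<psi> \<and> compact (closure {x. \<psi> x \<noteq> 0}) \<and> closure {x. \<psi> x \<noteq> 0} \<subseteq> S"

definition classical_grad :: "('a::euclidean_space \<Rightarrow> real) \<Rightarrow> 'a \<Rightarrow> 'a" where
  "classical_grad \<psi> x = (\<Sum>b\<in>Basis. frechet_derivative \<psi> (at x) b *\<^sub>R b)"

definition is_weak_grad :: "'a::euclidean_space set \<Rightarrow> ('a \<Rightarrow> real) \<Rightarrow> ('a \<Rightarrow> 'a) \<Rightarrow> bool" where
  "is_weak_grad \<omega> \<phi> G \<longleftrightarrow> G \<in> L2 (lebesgue_on \<omega>) \<and>
     (\<forall>\<psi>. test_fun \<omega> \<psi> \<longrightarrow>
        (LINT x|lebesgue_on \<omega>. \<phi> x *\<^sub>R classical_grad \<psi> x) = - (LINT x|lebesgue_on \<omega>. \<psi> x *\<^sub>R G x))"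

definition is_weak_div :: "'a::euclidean_space set \<Rightarrow> ('a \<Rightarrow> 'a) \<Rightarrow> ('a \<Rightarrow> real) \<Rightarrow> bool" where
  "is_weak_div \<omega> u d \<longleftrightarrow> d \<in> L2 (lebesgue_on \<omega>) \<and>
     (\<forall>\<psi>. test_fun \<omega> \<psi> \<longrightarrow>
        (LINT x|lebesgue_on \<omega>. u x \<bullet> classical_grad \<psi> x) = - (LINT x|lebesgue_on \<omega>. \<psi> x * d x))"

text \<open>Weak derivatives are determined almost everywhere, so the choice below is immaterial.\<close>

definition grad :: "'a::euclidean_space set \<Rightarrow> ('a \<Rightarrow> real) \<Rightarrow> 'a \<Rightarrow> 'a" where
  "grad \<omega> \<phi> = (SOME G. is_weak_grad \<omega> \<phi> G)"

definition wdiv :: "'a::euclidean_space set \<Rightarrow> ('a \<Rightarrow> 'a) \<Rightarrow> 'a \<Rightarrow> real" where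
  "wdiv \<omega> u = (SOME d. is_weak_div \<omega> u d)"

definition H1 :: "'a::euclidean_space set \<Rightarrow> ('a \<Rightarrow> real) set" where
  "H1 \<omega> = {\<phi> \<in> L2 (lebesgue_on \<omega>). \<exists>G. is_weak_grad \<omega> \<phi> G}"


section \<open>Surface integrals, normals and traces\<close>

text \<open>The \<open>(n-1)\<close>-dimensional Lebesgue measure on a hyperplane \<open>H\<close>: the measure of \<open>A\<close> is the
  volume of the prism of height one over \<open>A \<inter> H\<close>, the points at distance at most \<open>1/2\<close>
  from \<open>H\<close> whose orthogonal projection lies in \<open>A\<close>. In dimension one, where \<open>H\<close> is a
  point, it is the counting measure.\<close>

definition plane_measure :: "'a::euclidean_space set \<Rightarrow> 'a measure" where
  "plane_measure H =
     completion (distr (restrict_space lborel {x. infdist x H \<le> 1 / 2}) borel (closest_point H))"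

text \<open>The hyperplanes that contain a part of \<open>S\<close> of positive surface measure. All surfaces
  below are pieces of boundaries of polyhedra, so there are finitely many of these. Distinct
  hyperplanes meet in a set of surface measure zero, so the sum in \<open>surf_int\<close> is the
  integral over \<open>S\<close> with respect to surface measure.\<close>

definition planes :: "'a::euclidean_space set \<Rightarrow> 'a set set" where
  "planes S = {H. (\<exists>a b. a \<noteq> 0 \<and> H = {x. a \<bullet> x = b}) \<and> emeasure (plane_measure H) S \<noteq> 0}"

definition surf_int :: "'a::euclidean_space set \<Rightarrow> ('a \<Rightarrow> real) \<Rightarrow> real" where
  "surf_int S f = (\<Sum>H\<in>planes S. set_lebesgue_integral (plane_measure H) S f)"

definition surf_L2 :: "'a::euclidean_space set \<Rightarrow> ('a \<Rightarrow> real) set" where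
  "surf_L2 S = {f. \<forall>H\<in>planes S. f \<in> L2 (restrict_space (plane_measure H) S)}"

definition surf_AE :: "'a::euclidean_space set \<Rightarrow> ('a \<Rightarrow> bool) \<Rightarrow> bool" where
  "surf_AE S P \<longleftrightarrow> (\<forall>H\<in>planes S. AE x in plane_measure H. x \<in> S \<longrightarrow> P x)"

definition is_normal :: "'a::euclidean_space set \<Rightarrow> 'a \<Rightarrow> 'a \<Rightarrow> bool" where
  "is_normal \<omega> x n \<longleftrightarrow> norm n = 1 \<and> (\<exists>r>0. \<forall>y\<in>ball x r. y \<in> \<omega> \<longleftrightarrow> n \<bullet> (y - x) < 0)"

definition normal :: "'a::euclidean_space set \<Rightarrow> 'a \<Rightarrow> 'a" where
  "normal \<omega> x = (THE n. is_normal \<omega> x n)"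

text \<open>The boundary points with an outward normal. For a polyhedron this is the boundary without
  the faces of codimension two or more, which have surface measure zero.\<close>

definition bdry :: "'a::euclidean_space set \<Rightarrow> 'a set" where
  "bdry \<omega> = {x. \<exists>n. is_normal \<omega> x n}"

text \<open>The trace on the boundary of \<open>\<omega>\<close>, as the limit of the mean values over \<open>\<omega> \<inter> ball x r\<close>.
  For functions with a continuous extension to \<open>closure \<omega>\<close> this is the boundary value, and
  for functions in \<open>H1 \<omega>\<close> it agrees almost everywhere with the Sobolev trace.\<close>

definition mean_val :: "'a::euclidean_space set \<Rightarrow> ('a \<Rightarrow> real) \<Rightarrow> 'a \<Rightarrow> real \<Rightarrow> real" where
  "mean_val \<omega> f x r =
     (LINT y|lebesgue_on (\<omega> \<inter> ball x r). f y) / measure lebesgue (\<omega> \<inter> ball x r)"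

definition tr :: "'a::euclidean_space set \<Rightarrow> ('a \<Rightarrow> real) \<Rightarrow> 'a \<Rightarrow> real" where
  "tr \<omega> f x = Lim (at_right 0) (mean_val \<omega> f x)"

definition tr_vec :: "'a::euclidean_space set \<Rightarrow> ('a \<Rightarrow> 'a) \<Rightarrow> 'a \<Rightarrow> 'a" where
  "tr_vec \<omega> u x = (\<Sum>b\<in>Basis. tr \<omega> (\<lambda>y. u y \<bullet> b) x *\<^sub>R b)"

text \<open>By the trace theorem every function in \<open>H1 \<omega>\<close>, for a polyhedron \<open>\<omega>\<close>, has this property.\<close>

definition has_trace :: "'a::euclidean_space set \<Rightarrow> ('a \<Rightarrow> real) \<Rightarrow> bool" where
  "has_trace \<omega> f \<longleftrightarrow>
     surf_AE (bdry \<omega>) (\<lambda>x. \<exists>l. (mean_val \<omega> f x \<longlongrightarrow> l) (at_right 0)) \<and>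
     tr \<omega> f \<in> surf_L2 (bdry \<omega>)"


section \<open>Meshes\<close>

text \<open>Polyhedra need not be convex.\<close>

definition open_polyhedron :: "'a::euclidean_space set \<Rightarrow> bool" where
  "open_polyhedron \<omega> \<longleftrightarrow> \<omega> \<noteq> {} \<and>
     (\<exists>\<P>. finite \<P> \<and> (\<forall>P\<in>\<P>. polytope P) \<and> \<omega> = interior (\<Union>\<P>))"

definition is_mesh :: "'a::euclidean_space set \<Rightarrow> 'a set set \<Rightarrow> bool" where
  "is_mesh \<Omega> \<T> \<longleftrightarrow> finite \<T> \<and> (\<forall>\<omega>\<in>\<T>. open_polyhedron \<omega>) \<and> disjoint \<T> \<and>
     closure \<Omega> = (\<Union>\<omega>\<in>\<T>. closure \<omega>)"

text \<open>The directions in which \<open>\<omega>\<close> is translation invariant near \<open>x\<close>. For a polyhedron, a point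
  of \<open>closure \<omega>\<close> lies in the relative interior of a one-dimensional face exactly when these
  directions form a line, the direction of that face.\<close>

definition invariant_dirs :: "'a::euclidean_space set \<Rightarrow> 'a \<Rightarrow> 'a set" where
  "invariant_dirs \<omega> x = {d. \<exists>r>0. \<forall>y\<in>ball x r. \<forall>t.
     y + t *\<^sub>R d \<in> ball x r \<longrightarrow> (y \<in> \<omega> \<longleftrightarrow> y + t *\<^sub>R d \<in> \<omega>)}"

text \<open>Length of the largest (one-dimensional) edge; the length of \<open>\<omega>\<close> for an interval \<open>\<omega>\<close>.\<close>

definition elem_size :: "'a::euclidean_space set \<Rightarrow> real" where
  "elem_size \<omega> = Sup {dist a b | a b. a \<noteq> b \<and>
     (\<forall>x\<in>open_segment a b. x \<in> closure \<omega> \<and> invariant_dirs \<omega> x = span {b - a})}"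

text \<open>An interior edge is represented by the set \<open>e\<close> of the two elements that share it. All
  expressions below are symmetric in the two elements, which therefore need no labels
  \<open>+\<close> and \<open>-\<close>.\<close>

definition int_edges :: "'a::euclidean_space set set \<Rightarrow> 'a set set set" where
  "int_edges \<T> = {{\<omega>, \<omega>'} | \<omega> \<omega>'. \<omega> \<in> \<T> \<and> \<omega>' \<in> \<T> \<and> \<omega> \<noteq> \<omega>' \<and> planes (bdry \<omega> \<inter> bdry \<omega>') \<noteq> {}}"

definition edge_pts :: "'a::euclidean_space set set \<Rightarrow> 'a set" where
  "edge_pts e = (\<Inter>\<omega>\<in>e. bdry \<omega>)"

definition edge_size :: "'a::euclidean_space set set \<Rightarrow> real" where
  "edge_size e = (\<Sum>\<omega>\<in>e. elem_size \<omega>) / 2"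

definition avg :: "'a::euclidean_space set set \<Rightarrow> ('a \<Rightarrow> real) \<Rightarrow> 'a \<Rightarrow> real" where
  "avg e \<phi> x = (\<Sum>\<omega>\<in>e. tr \<omega> \<phi> x) / 2"

definition jump :: "'a::euclidean_space set set \<Rightarrow> ('a \<Rightarrow> real) \<Rightarrow> 'a \<Rightarrow> 'a" where
  "jump e \<phi> x = (\<Sum>\<omega>\<in>e. tr \<omega> \<phi> x *\<^sub>R normal \<omega> x)"

definition jump_vec :: "'a::euclidean_space set set \<Rightarrow> ('a \<Rightarrow> 'a) \<Rightarrow> 'a \<Rightarrow> real" where
  "jump_vec e \<tau> x = (\<Sum>\<omega>\<in>e. tr_vec \<omega> \<tau> x \<bullet> normal \<omega> x)"

text \<open>The integrands depend on the element (\<open>vol_ip\<close>, \<open>bdry_ip\<close>) or the edge (\<open>edge_ip\<close>)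
  through elementwise derivatives and traces.\<close>

definition vol_ip ::
    "'a::euclidean_space set set \<Rightarrow> ('a set \<Rightarrow> 'a \<Rightarrow> 'b::euclidean_space) \<Rightarrow> ('a set \<Rightarrow> 'a \<Rightarrow> 'b) \<Rightarrow> real" where
  "vol_ip \<T> F G = (\<Sum>\<omega>\<in>\<T>. LINT x|lebesgue_on \<omega>. F \<omega> x \<bullet> G \<omega> x)"

definition edge_ip ::
    "'a::euclidean_space set set \<Rightarrow> ('a set set \<Rightarrow> 'a \<Rightarrow> 'b::euclidean_space) \<Rightarrow> ('a set set \<Rightarrow> 'a \<Rightarrow> 'b) \<Rightarrow> real" where
  "edge_ip \<T> F G = (\<Sum>e\<in>int_edges \<T>. surf_int (edge_pts e) (\<lambda>x. F e x \<bullet> G e x))"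

definition bdry_ip ::
    "'a::euclidean_space set \<Rightarrow> 'a set set \<Rightarrow> 'a set \<Rightarrow> ('a set \<Rightarrow> 'a \<Rightarrow> real) \<Rightarrow> ('a set \<Rightarrow> 'a \<Rightarrow> real) \<Rightarrow> real" where
  "bdry_ip \<Omega> \<T> \<Gamma> F G = (\<Sum>\<omega>\<in>\<T>. surf_int (\<Gamma> \<inter> bdry \<Omega> \<inter> bdry \<omega>) (\<lambda>x. F \<omega> x * G \<omega> x))"


section \<open>Problem data and spaces\<close>

text \<open>The two pore-networks have indices 1 and 2. The constants \<open>\<mu>\<close>, \<open>\<gamma>\<close>, \<open>\<beta>\<close> are \<open>visc\<close>,
  \<open>dens\<close>, \<open>transfer_coeff\<close>.\<close>

record 'a dpp =
  region :: "'a set"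
  mesh :: "'a set set"
  bd_u :: "nat \<Rightarrow> 'a set"
  bd_p :: "nat \<Rightarrow> 'a set"
  u_n :: "nat \<Rightarrow> 'a \<Rightarrow> real"
  p_0 :: "nat \<Rightarrow> 'a \<Rightarrow> real"
  visc :: real
  dens :: real
  transfer_coeff :: real
  body_force :: "nat \<Rightarrow> 'a \<Rightarrow> 'a"
  perm :: "nat \<Rightarrow> 'a \<Rightarrow> real"
  eta_u :: real
  eta_p :: real

text \<open>A closed union of polyhedra has a smooth boundary in dimension one only. Of smoothness
  we keep that the domain lies on one side of its boundary, so that the outward normal exists
  almost everywhere on the boundary.\<close>

definition dpp_data :: "'a::euclidean_space dpp \<Rightarrow> bool" where
  "dpp_data D \<longleftrightarrow>
     open (region D) \<and> bounded (region D) \<and> connected (region D) \<and> region D \<noteq> {} \<and>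
     interior (closure (region D)) = region D \<and>
     is_mesh (region D) (mesh D) \<and>
     visc D > 0 \<and> dens D > 0 \<and> transfer_coeff D > 0 \<and> eta_u D \<ge> 0 \<and> eta_p D \<ge> 0 \<and>
     (\<forall>i\<in>{1, 2}.
        bd_u D i \<in> sets borel \<and> bd_p D i \<in> sets borel \<and>
        frontier (region D) = bd_u D i \<union> bd_p D i \<and> bd_u D i \<inter> bd_p D i = {} \<and>
        perm D i \<in> borel_measurable (lebesgue_on (region D)) \<and>
        (\<exists>m M. 0 < m \<and> (\<forall>x\<in>region D. m \<le> visc D / perm D i x \<and> visc D / perm D i x \<le> M)))"

text \<open>Fields are total functions, only the values on the elements matter.\<close>

definition vel_space :: "'a::euclidean_space set set \<Rightarrow> ('a \<Rightarrow> 'a) set" where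
  "vel_space \<T> = {u. \<forall>\<omega>\<in>\<T>. u \<in> L2 (lebesgue_on \<omega>) \<and> (\<exists>d. is_weak_div \<omega> u d) \<and>
     (\<forall>b\<in>Basis. (\<lambda>x. u x \<bullet> b) \<in> H1 \<omega> \<and> has_trace \<omega> (\<lambda>x. u x \<bullet> b))}"

definition pres_space :: "'a::euclidean_space set set \<Rightarrow> (('a \<Rightarrow> real) \<times> ('a \<Rightarrow> real)) set" where
  "pres_space \<T> = {(p1, p2).
     (\<forall>\<omega>\<in>\<T>. p1 \<in> H1 \<omega> \<and> has_trace \<omega> p1 \<and> p2 \<in> H1 \<omega> \<and> has_trace \<omega> p2) \<and>
     (\<Sum>\<omega>\<in>\<T>. LINT x|lebesgue_on \<omega>. p1 x) * (\<Sum>\<omega>\<in>\<T>. LINT x|lebesgue_on \<omega>. p2 x) = 0}"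

definition poly_le :: "nat \<Rightarrow> ('a::euclidean_space \<Rightarrow> real) \<Rightarrow> bool" where
  "poly_le k P \<longleftrightarrow> (\<exists>c. \<forall>x. P x =
     (\<Sum>\<alpha> | (\<forall>b. b \<notin> Basis \<longrightarrow> \<alpha> b = (0::nat)) \<and> (\<Sum>b\<in>Basis. \<alpha> b) \<le> k. c \<alpha> * (\<Prod>b\<in>Basis. (x \<bullet> b) ^ \<alpha> b)))"

text \<open>A field that is a polynomial on \<open>\<omega>\<close> has a unique continuous extension to \<open>closure \<omega>\<close>.\<close>

definition vel_space_h :: "'a::euclidean_space set set \<Rightarrow> nat \<Rightarrow> ('a \<Rightarrow> 'a) set" where
  "vel_space_h \<T> k = {u \<in> vel_space \<T>.
     \<forall>\<omega>\<in>\<T>. \<forall>b\<in>Basis. \<exists>P. poly_le k P \<and> (\<forall>x\<in>\<omega>. u x \<bullet> b = P x)}"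

definition pres_space_h :: "'a::euclidean_space set set \<Rightarrow> nat \<Rightarrow> (('a \<Rightarrow> real) \<times> ('a \<Rightarrow> real)) set" where
  "pres_space_h \<T> l = {(p1, p2) \<in> pres_space \<T>.
     \<forall>\<omega>\<in>\<T>. (\<exists>P. poly_le l P \<and> (\<forall>x\<in>\<omega>. p1 x = P x)) \<and> (\<exists>P. poly_le l P \<and> (\<forall>x\<in>\<omega>. p2 x = P x))}"

type_synonym 'a fields = "('a \<Rightarrow> 'a) \<times> ('a \<Rightarrow> 'a) \<times> ('a \<Rightarrow> real) \<times> ('a \<Rightarrow> real)"

definition U_space :: "'a::euclidean_space dpp \<Rightarrow> 'a fields set" where
  "U_space D = vel_space (mesh D) \<times> vel_space (mesh D) \<times> pres_space (mesh D)"

definition U_space_h :: "'a::euclidean_space dpp \<Rightarrow> nat \<Rightarrow> nat \<Rightarrow> 'a fields set" where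
  "U_space_h D k l = vel_space_h (mesh D) k \<times> vel_space_h (mesh D) k \<times> pres_space_h (mesh D) l"


section \<open>The stabilized mixed DG forms\<close>

definition drag :: "'a dpp \<Rightarrow> nat \<Rightarrow> 'a \<Rightarrow> real" where
  "drag D i x = visc D / perm D i x"

definition mobility :: "'a dpp \<Rightarrow> nat \<Rightarrow> 'a \<Rightarrow> real" where
  "mobility D i x = perm D i x / visc D"

definition B_net :: "'a::euclidean_space dpp \<Rightarrow> nat \<Rightarrow>
    ('a \<Rightarrow> 'a) \<Rightarrow> ('a \<Rightarrow> real) \<Rightarrow> ('a \<Rightarrow> 'a) \<Rightarrow> ('a \<Rightarrow> real) \<Rightarrow> real" where
  "B_net D i w q u p = (let \<T> = mesh D; \<Omega> = region D; \<kappa> = drag D i; m = mobility D i in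
       vol_ip \<T> (\<lambda>_. w) (\<lambda>_ x. \<kappa> x *\<^sub>R u x)
     - vol_ip \<T> (\<lambda>\<omega>. wdiv \<omega> w) (\<lambda>_. p)
     + vol_ip \<T> (\<lambda>_. q) (\<lambda>\<omega>. wdiv \<omega> u)
     + edge_ip \<T> (\<lambda>e. jump_vec e w) (\<lambda>e. avg e p)
     - edge_ip \<T> (\<lambda>e. avg e q) (\<lambda>e. jump_vec e u)
     + bdry_ip \<Omega> \<T> (bd_u D i) (\<lambda>\<omega> x. tr_vec \<omega> w x \<bullet> normal \<Omega> x) (\<lambda>\<omega>. tr \<omega> p)
     - bdry_ip \<Omega> \<T> (bd_u D i) (\<lambda>\<omega>. tr \<omega> q) (\<lambda>\<omega> x. tr_vec \<omega> u x \<bullet> normal \<Omega> x)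
     - 1 / 2 * vol_ip \<T> (\<lambda>\<omega> x. \<kappa> x *\<^sub>R w x - grad \<omega> q x) (\<lambda>\<omega> x. m x *\<^sub>R (\<kappa> x *\<^sub>R u x + grad \<omega> p x))
     + edge_ip \<T> (\<lambda>e x. eta_u D * edge_size e * avg e \<kappa> x * jump_vec e w x) (\<lambda>e. jump_vec e u)
     + edge_ip \<T> (\<lambda>e x. (eta_p D / edge_size e * avg e m x) *\<^sub>R jump e q x) (\<lambda>e. jump e p))"

fun B_stab :: "'a::euclidean_space dpp \<Rightarrow> 'a fields \<Rightarrow> 'a fields \<Rightarrow> real" where
  "B_stab D (w1, w2, q1, q2) (u1, u2, p1, p2) =
     B_net D 1 w1 q1 u1 p1 + B_net D 2 w2 q2 u2 p2
     + vol_ip (mesh D) (\<lambda>_ x. q1 x - q2 x) (\<lambda>_ x. transfer_coeff D / visc D * (p1 x - p2 x))"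

definition L_net :: "'a::euclidean_space dpp \<Rightarrow> nat \<Rightarrow> ('a \<Rightarrow> 'a) \<Rightarrow> ('a \<Rightarrow> real) \<Rightarrow> real" where
  "L_net D i w q = (let \<T> = mesh D; \<Omega> = region D; \<kappa> = drag D i; m = mobility D i in
       vol_ip \<T> (\<lambda>_. w) (\<lambda>_ x. dens D *\<^sub>R body_force D i x)
     - bdry_ip \<Omega> \<T> (bd_p D i) (\<lambda>\<omega> x. tr_vec \<omega> w x \<bullet> normal \<Omega> x) (\<lambda>_. p_0 D i)
     - bdry_ip \<Omega> \<T> (bd_u D i) (\<lambda>\<omega>. tr \<omega> q) (\<lambda>_. u_n D i)
     - 1 / 2 * vol_ip \<T> (\<lambda>\<omega> x. \<kappa> x *\<^sub>R w x - grad \<omega> q x) (\<lambda>_ x. (m x * dens D) *\<^sub>R body_force D i x))"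

fun L_stab :: "'a::euclidean_space dpp \<Rightarrow> 'a fields \<Rightarrow> real" where
  "L_stab D (w1, w2, q1, q2) = L_net D 1 w1 q1 + L_net D 2 w2 q2"

end

theory Submission
  imports Defs "HOL-Computational_Algebra.Polynomial"
begin

text \<open>Galerkin orthogonality is the linearity of \<open>B_stab\<close> in its second argument, applied to
  \<open>Uh - U\<close> and tested with \<open>Wh\<close>, on which both solutions produce the same load. Linearity is not
  formal here. The weak gradient and divergence are choices, hence linear only up to null sets, by
  uniqueness of weak derivatives: a function orthogonal to all test functions has zero integral
  over every box, so it vanishes almost everywhere by Lebesgue differentiation. The traces are
  limits of mean values, hence additive almost everywhere where they exist. Finally every product
  under an integral has to be integrable; for the weights of the penalty terms this requires
  that the trace of a bounded coefficient, which need not exist as a limit, is still a bounded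
  Borel function.\<close>

section \<open>Uniqueness of weak derivatives\<close>

text \<open>The error need not lie in \<open>U_space D\<close>: the condition that the product of
  the two pressure integrals vanishes is not preserved by differences. Linearity is therefore proved
  on the larger class \<open>broken_H1\<close>, which keeps elementwise regularity and traces but
  carries no mean-value condition. Integrability matters because the Bochner integral of a
  non-integrable function is 0 by convention, so additivity can fail; each product is made
  integrable by placing both factors in \<open>L2\<close>. On surfaces there is a second obstacle: a
  hyperplane is Lebesgue-null, so Lebesgue measurability of a field says nothing about functions on
  it. What saves the traces is that mean values over balls are Borel functions of the centre. The
  trace itself is a \<open>Lim\<close>, equal to the unspecified constant
  \<open>THE l. False\<close> where no limit exists, so its measurability also depends on the set of
  points at which the limit exists.\<close>

primrec exp_poly :: "nat \<Rightarrow> real poly" where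
  "exp_poly 0 = 1"
| "exp_poly (Suc n) = monom 1 2 * (exp_poly n - pderiv (exp_poly n))"

text \<open>The \<open>n\<close>-th derivative of the flat function exp(-1/t), extended by zero.
  With s = 1/t the product rule gives (P(s) exp(-s))' = s^2 (P - P')(s) exp(-s), which is the
  recursion of \<open>exp_poly\<close>.\<close>

definition exp_bump :: "nat \<Rightarrow> real \<Rightarrow> real" where
  "exp_bump n t = (if t > 0 then poly (exp_poly n) (1 / t) * exp (- (1 / t)) else 0)"

section \<open>Smooth bumps supported in boxes\<close>

lemma poly_exp_minus_tendsto_0: "((\<lambda>s. poly p s * exp (- s)) \<longlongrightarrow> 0) at_top" for p :: "real poly"
proof -
  have "((\<lambda>s. \<Sum>i\<le>degree p. coeff p i * (s ^ i / exp s)) \<longlongrightarrow> (\<Sum>i\<le>degree p. coeff p i * 0)) at_top"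
    by (intro tendsto_intros tendsto_power_div_exp_0)
  then show ?thesis
    by (simp add: poly_altdef sum_distrib_right exp_minus divide_inverse mult.assoc)
qed

lemma exp_bump_has_real_derivative:
  "(exp_bump n has_real_derivative exp_bump (Suc n) t) (at t)"
proof -
  consider "t > 0" | "t < 0" | "t = 0" by linarith
  then show ?thesis
  proof cases
    case 1
    have "((\<lambda>t. poly (exp_poly n) (1 / t) * exp (- (1 / t))) has_real_derivative exp_bump (Suc n) t) (at t)"
      using 1 by (auto intro!: derivative_eq_intros poly_DERIV[THEN DERIV_chain2]
          simp: exp_bump_def poly_monom field_simps power2_eq_square)
    then show ?thesis
      by (rule has_field_derivative_transform_within_open[where S = "{0<..}"])
         (use 1 in \<open>auto simp: exp_bump_def\<close>)
  next
    case 2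
    have "((\<lambda>t. 0) has_real_derivative exp_bump (Suc n) t) (at t)"
      using 2 by (simp add: exp_bump_def)
    then show ?thesis
      by (rule has_field_derivative_transform_within_open[where S = "{..<0}"])
         (use 2 in \<open>auto simp: exp_bump_def\<close>)
  next
    case 3
    have "((\<lambda>h. exp_bump n h / h) \<longlongrightarrow> 0) (at_right 0)"
    proof -
      \<comment> \<open>The difference quotient at 0 is P(s) exp(-s) / h with s = 1/h; the division
        by \<open>h\<close> becomes the extra factor \<open>monom 1 1\<close>.\<close>
      have "((\<lambda>s. poly (monom 1 1 * exp_poly n) s * exp (- s)) \<longlongrightarrow> 0) at_top"
        by (rule poly_exp_minus_tendsto_0)
      then have "((\<lambda>h. poly (monom 1 1 * exp_poly n) (inverse h) * exp (- inverse h)) \<longlongrightarrow> 0) (at_right 0)"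
        using filterlim_inverse_at_top_right by (rule filterlim_compose)
      then show ?thesis
        by (rule Lim_transform_eventually)
           (auto simp: eventually_at_filter exp_bump_def poly_monom field_simps)
    qed
    moreover have "((\<lambda>h. exp_bump n h / h) \<longlongrightarrow> 0) (at_left 0)"
      by (rule Lim_transform_eventually[OF tendsto_const])
         (auto simp: eventually_at_filter exp_bump_def)
    ultimately have "((\<lambda>h. exp_bump n h / h) \<longlongrightarrow> 0) (at 0)"
      by (intro filterlim_split_at)
    then show ?thesis
      using 3 by (simp add: DERIV_def exp_bump_def)
  qed
qed

text \<open>\<open>smooth\<close> asks for all iterated partial derivatives at once. A set closed
  under partial differentiation provides them: choose partials for every member and iterate the
  choice.\<close>

lemma smooth_coinduct:
  assumes f: "f \<in> S"
    and S: "\<And>f. f \<in> S \<Longrightarrow> \<exists>d. (\<forall>b\<in>Basis. d b \<in> S) \<and>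
      (\<forall>x. (f has_derivative (\<lambda>v. \<Sum>b\<in>Basis. (v \<bullet> b) * d b x)) (at x))"
  shows "smooth (f :: 'a::euclidean_space \<Rightarrow> real)"
proof -
  have "\<forall>f\<in>S. \<exists>d. (\<forall>b\<in>Basis. d b \<in> S) \<and>
      (\<forall>x. (f has_derivative (\<lambda>v. \<Sum>b\<in>Basis. (v \<bullet> b) * d b x)) (at x))"
    using S by blast
  from bchoice[OF this] obtain d where
    d: "\<forall>f\<in>S. (\<forall>b\<in>Basis. d f b \<in> S) \<and>
      (\<forall>x. (f has_derivative (\<lambda>v. \<Sum>b\<in>Basis. (v \<bullet> b) * d f b x)) (at x))"
    by blast
  \<comment> \<open>\<open>smooth\<close> quantifies over all lists, while closure of
    \<open>S\<close> is known for basis directions only; other entries are skipped, so that every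
    \<open>D bs\<close> stays in \<open>S\<close>.\<close>
  define D where "D bs = foldr (\<lambda>b g. if b \<in> Basis then d g b else g) bs f" for bs
  have "D bs \<in> S" for bs
    by (induction bs) (use d in \<open>auto simp: D_def f\<close>)
  then show ?thesis
    unfolding smooth_def
    using d by (intro exI[of _ D]) (auto simp: D_def cong: sum.cong)
qed

lemma smooth_partials:
  assumes "smooth (f :: 'a::euclidean_space \<Rightarrow> real)"
  shows "\<exists>d. (\<forall>b. smooth (d b)) \<and>
    (\<forall>x. (f has_derivative (\<lambda>v. \<Sum>b\<in>Basis. (v \<bullet> b) * d b x)) (at x))"
proof -
  obtain D where D: "D [] = f"
    "\<And>bs x. (D bs has_derivative (\<lambda>v. \<Sum>b\<in>Basis. (v \<bullet> b) * D (b # bs) x)) (at x)"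
    using assms unfolding smooth_def by blast
  have "smooth (D [b])" for b
    \<comment> \<open>The head of a list is the direction differentiated last, so the iterated
      partials of \<open>D [b]\<close> carry \<open>b\<close> at the end of the list.\<close>
    unfolding smooth_def by (intro exI[of _ "\<lambda>bs. D (bs @ [b])"]) (simp add: D(2))
  with D(2)[of "[]"] show ?thesis
    unfolding D(1) by (intro exI[of _ "\<lambda>b. D [b]"]) simp
qed

lemma smooth_continuous_on:
  assumes "smooth f"
  shows "continuous_on S f"
proof -
  obtain d where "\<And>b. smooth (d b)"
    and "\<And>x. (f has_derivative (\<lambda>v. \<Sum>b\<in>Basis. (v \<bullet> b) * d b x)) (at x)"
    using smooth_partials[OF assms] by blast
  from this(2) show ?thesis
    by (intro continuous_at_imp_continuous_on ballI has_derivative_continuous)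
qed

text \<open>\<open>frechet_derivative\<close> is a choice; uniqueness of the derivative identifies
  its components with the partials from \<open>smooth_partials\<close>, which are smooth and hence
  continuous.\<close>

lemma classical_grad_continuous_on:
  assumes "smooth f"
  shows "continuous_on S (classical_grad f)"
proof -
  obtain d where d: "\<And>b. smooth (d b)"
    and f: "\<And>x. (f has_derivative (\<lambda>v. \<Sum>b\<in>Basis. (v \<bullet> b) * d b x)) (at x)"
    using smooth_partials[OF assms] by blast
  have "classical_grad f x = (\<Sum>b\<in>Basis. d b x *\<^sub>R b)" for x
    unfolding classical_grad_def frechet_derivative_at[OF f, symmetric]
    by (intro sum.cong) (auto simp: inner_Basis if_distrib[where f = "\<lambda>z. z * y" for y] cong: if_cong)
  then have "classical_grad f = (\<lambda>x. \<Sum>b\<in>Basis. d b x *\<^sub>R b)" by auto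
  then show ?thesis
    by (auto intro!: continuous_intros smooth_continuous_on d)
qed

text \<open>A class that contains the box bumps and is closed under partial differentiation, as
  \<open>smooth_coinduct\<close> requires: a generator goes to a constant times the generator with
  index \<open>Suc n\<close>, and the product rule stays inside sums and products. Constants supply
  the factors \<open>v \<bullet> b\<close>.\<close>

inductive_set bump_algebra :: "('a::euclidean_space \<Rightarrow> real) set" where
  exp_bump: "(\<lambda>x. exp_bump n (x \<bullet> v + c)) \<in> bump_algebra"
| const: "(\<lambda>x. c) \<in> bump_algebra"
| add: "f \<in> bump_algebra \<Longrightarrow> g \<in> bump_algebra \<Longrightarrow> (\<lambda>x. f x + g x) \<in> bump_algebra"
| mult: "f \<in> bump_algebra \<Longrightarrow> g \<in> bump_algebra \<Longrightarrow> (\<lambda>x. f x * g x) \<in> bump_algebra"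

lemma bump_algebra_prod:
  assumes "\<And>i. i \<in> I \<Longrightarrow> f i \<in> bump_algebra"
  shows "(\<lambda>x. \<Prod>i\<in>I. f i x) \<in> bump_algebra"
  using assms by (induction I rule: infinite_finite_induct) (auto intro: bump_algebra.intros)

lemma bump_algebra_smooth:
  assumes "f \<in> bump_algebra"
  shows "smooth (f :: 'a::euclidean_space \<Rightarrow> real)"
  using assms
proof (rule smooth_coinduct)
  fix f :: "'a \<Rightarrow> real"
  assume "f \<in> bump_algebra"
  then show "\<exists>d. (\<forall>b\<in>Basis. d b \<in> bump_algebra) \<and>
      (\<forall>x. (f has_derivative (\<lambda>v. \<Sum>b\<in>Basis. (v \<bullet> b) * d b x)) (at x))"
  proof induction
    case (exp_bump n v c)
    have "((\<lambda>x. exp_bump n (x \<bullet> v + c)) has_derivative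
        (\<lambda>h. \<Sum>b\<in>Basis. (h \<bullet> b) * ((v \<bullet> b) * exp_bump (Suc n) (x \<bullet> v + c)))) (at x)" for x
    proof -
      have "(exp_bump n has_derivative (\<lambda>h. exp_bump (Suc n) (x \<bullet> v + c) * h)) (at (x \<bullet> v + c))"
        using exp_bump_has_real_derivative by (simp add: has_field_derivative_def)
      then have "((\<lambda>x. exp_bump n (x \<bullet> v + c)) has_derivative
          (\<lambda>h. exp_bump (Suc n) (x \<bullet> v + c) * (h \<bullet> v))) (at x)"
        by (rule has_derivative_compose[rotated]) (auto intro!: derivative_eq_intros)
      also have "(\<lambda>h. exp_bump (Suc n) (x \<bullet> v + c) * (h \<bullet> v)) =
          (\<lambda>h. \<Sum>b\<in>Basis. (h \<bullet> b) * ((v \<bullet> b) * exp_bump (Suc n) (x \<bullet> v + c)))"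
        by (subst euclidean_inner) (simp add: sum_distrib_left mult_ac)
      finally show ?thesis .
    qed
    then show ?case
      by (intro exI[of _ "\<lambda>b x. (v \<bullet> b) * exp_bump (Suc n) (x \<bullet> v + c)"])
         (auto intro: bump_algebra.intros)
  next
    case (const c)
    show ?case
      by (intro exI[of _ "\<lambda>b x. 0"]) (auto intro: bump_algebra.intros)
  next
    case (add f g)
    then obtain d e where "\<forall>b\<in>Basis. d b \<in> bump_algebra" "\<forall>b\<in>Basis. e b \<in> bump_algebra"
      "\<And>x. (f has_derivative (\<lambda>v. \<Sum>b\<in>Basis. (v \<bullet> b) * d b x)) (at x)"
      "\<And>x. (g has_derivative (\<lambda>v. \<Sum>b\<in>Basis. (v \<bullet> b) * e b x)) (at x)"
      by blast
    then show ?case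
      by (intro exI[of _ "\<lambda>b x. d b x + e b x"])
         (auto intro!: bump_algebra.intros derivative_eq_intros ext simp: sum.distrib algebra_simps)
  next
    case (mult f g)
    then obtain d e where "\<forall>b\<in>Basis. d b \<in> bump_algebra" "\<forall>b\<in>Basis. e b \<in> bump_algebra"
      "\<And>x. (f has_derivative (\<lambda>v. \<Sum>b\<in>Basis. (v \<bullet> b) * d b x)) (at x)"
      "\<And>x. (g has_derivative (\<lambda>v. \<Sum>b\<in>Basis. (v \<bullet> b) * e b x)) (at x)"
      by blast
    with mult.hyps show ?case
      by (intro exI[of _ "\<lambda>b x. d b x * g x + f x * e b x"])
         (auto intro!: bump_algebra.intros derivative_eq_intros ext
               simp: sum.distrib sum_distrib_left sum_distrib_right algebra_simps)
  qed
qed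

text \<open>Scaling the argument by \<open>n\<close> replaces the standard bump by its \<open>n\<close>-th root, which tends to one
  without enlarging the support.\<close>

definition box_bump :: "'a::euclidean_space \<Rightarrow> 'a \<Rightarrow> nat \<Rightarrow> 'a \<Rightarrow> real" where
  "box_bump a c n x = (\<Prod>b\<in>Basis. exp_bump 0 (real (Suc n) * ((x - a) \<bullet> b)) *
     exp_bump 0 (real (Suc n) * ((c - x) \<bullet> b)))"

lemma exp_bump_0_bounds: "0 \<le> exp_bump 0 t" "exp_bump 0 t \<le> 1"
  by (auto simp: exp_bump_def)

lemma box_bump_bounds: "0 \<le> box_bump a c n x" "box_bump a c n x \<le> 1"
  unfolding box_bump_def
  by (auto intro!: prod_nonneg prod_le_1 mult_le_one simp: exp_bump_0_bounds)

lemma box_bump_nonzero_iff: "box_bump a c n x \<noteq> 0 \<longleftrightarrow> x \<in> box a c"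
  by (auto simp: box_bump_def exp_bump_def mem_box zero_less_mult_iff inner_diff_left)

lemma box_bump_tendsto: "(\<lambda>n. box_bump a c n x) \<longlonglongrightarrow> indicator (box a c) x"
proof (cases "x \<in> box a c")
  case True
  have lim: "(\<lambda>n. exp_bump 0 (real (Suc n) * t)) \<longlonglongrightarrow> 1" if "t > 0" for t :: real
  proof -
    have "(\<lambda>n. exp (- (inverse (real (Suc n)) * (1 / t)))) \<longlonglongrightarrow> exp (- (0 * (1 / t)))"
      by (intro tendsto_intros LIMSEQ_inverse_real_of_nat)
    moreover have "exp_bump 0 (real (Suc n) * t) = exp (- (inverse (real (Suc n)) * (1 / t)))" for n
      using that by (simp add: exp_bump_def zero_less_mult_iff divide_inverse)
    ultimately show ?thesis by simp
  qed
  have "(\<lambda>n. box_bump a c n x) \<longlonglongrightarrow> (\<Prod>b\<in>(Basis :: 'a set). 1 * 1)"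
    unfolding box_bump_def
    by (intro tendsto_intros lim) (use True in \<open>auto simp: mem_box inner_diff_left\<close>)
  with True show ?thesis by simp
next
  case False
  then show ?thesis
    using box_bump_nonzero_iff[of a c _ x] by simp
qed

lemma box_bump_test_fun:
  assumes "cbox a c \<subseteq> S"
  shows "test_fun S (box_bump a c n)"
proof -
  have "box_bump a c n \<in> bump_algebra"
  proof -
    \<comment> \<open>The factors of \<open>box_bump\<close> are brought to the affine form
      \<open>x \<bullet> v + c\<close> of the generators.\<close>
    have "(\<lambda>x. \<Prod>b\<in>Basis. exp_bump 0 (x \<bullet> (real (Suc n) *\<^sub>R b) + (- (real (Suc n) * (a \<bullet> b)))) *
        exp_bump 0 (x \<bullet> (- real (Suc n) *\<^sub>R b) + real (Suc n) * (c \<bullet> b))) \<in> bump_algebra"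
      by (intro bump_algebra_prod bump_algebra.intros)
    also have "(\<lambda>x. \<Prod>b\<in>Basis. exp_bump 0 (x \<bullet> (real (Suc n) *\<^sub>R b) + (- (real (Suc n) * (a \<bullet> b)))) *
        exp_bump 0 (x \<bullet> (- real (Suc n) *\<^sub>R b) + real (Suc n) * (c \<bullet> b))) = box_bump a c n"
      unfolding box_bump_def
      by (intro ext prod.cong arg_cong2[where f = "(*)"] arg_cong[where f = "exp_bump 0"])
         (auto simp: inner_diff_left algebra_simps)
    finally show ?thesis .
  qed
  moreover have "closure {x. box_bump a c n x \<noteq> 0} \<subseteq> cbox a c"
    by (simp add: box_bump_nonzero_iff closure_minimal[OF box_subset_cbox closed_cbox])
  ultimately show ?thesis
    using assms unfolding test_fun_def
    by (auto intro: bump_algebra_smooth closed_subset bounded_subset[OF bounded_cbox[of a c]] simp: compact_eq_bounded_closed)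
qed

section \<open>Separation of integrable functions by test functions\<close>

lemma test_funs_separate:
  fixes g :: "'a::euclidean_space \<Rightarrow> real"
  assumes S: "open S" and g: "integrable (lebesgue_on S) g"
    and 0: "\<And>\<psi>. test_fun S \<psi> \<Longrightarrow> (LINT x|lebesgue_on S. \<psi> x * g x) = 0"
  shows "AE x in lebesgue_on S. g x = 0"
proof -
  have S_leb: "S \<in> sets lebesgue" using S by simp
  \<comment> \<open>Extension by zero moves the problem to the whole space, where the
    differentiation theorem for averages over cubes is available.\<close>
  define f where "f x = (if x \<in> S then g x else 0)" for x
  have f: "integrable lebesgue f"
    using g Lebesgue_Measure.integrable_restrict_UNIV[OF S_leb, of g] unfolding f_def[abs_def] by blast
  then have f_cbox: "f integrable_on cbox a c" for a c
    by (meson integrable_on_lebesgue integrable_on_subcbox subset_UNIV)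
  have int_S: "(LINT x|lebesgue_on S. \<phi> x * g x) = (LINT x|lebesgue. \<phi> x * f x)" for \<phi> :: "'a \<Rightarrow> real"
    using S_leb by (subst integral_restrict_space)
      (auto simp: f_def indicator_def intro!: Bochner_Integration.integral_cong)
  have box0: "integral (cbox a c) f = 0" if sub: "cbox a c \<subseteq> S" for a c
  proof -
    have bm: "box_bump a c n \<in> borel_measurable lebesgue" for n
    proof -
      have "smooth (box_bump a c n)"
        using box_bump_test_fun[of a c UNIV n] by (simp add: test_fun_def)
      then have "box_bump a c n \<in> borel_measurable borel"
        by (intro borel_measurable_continuous_onI smooth_continuous_on)
      then show ?thesis
        by (simp add: measurable_completion)
    qed
    \<comment> \<open>The bumps lie between 0 and 1 and tend to the indicator of the open box, so
      \<open>norm (f x)\<close> is a dominating function.\<close>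
    have "(\<lambda>n. LINT x|lebesgue. box_bump a c n x * f x) \<longlonglongrightarrow>
        (LINT x|lebesgue. indicator (box a c) x * f x)"
    proof (rule integral_dominated_convergence[where w = "\<lambda>x. norm (f x)"])
      show "AE x in lebesgue. (\<lambda>n. box_bump a c n x * f x) \<longlonglongrightarrow> indicator (box a c) x * f x"
        by (intro AE_I2 tendsto_intros box_bump_tendsto)
      show "AE x in lebesgue. norm (box_bump a c n x * f x) \<le> norm (f x)" for n
        using box_bump_bounds[of a c n]
        by (auto intro!: AE_I2 mult_left_le_one_le simp: abs_mult)
      have "f \<in> borel_measurable lebesgue" "indicator (box a c) \<in> borel_measurable lebesgue"
        using f by (auto intro!: borel_measurable_indicator)
      then show "(\<lambda>x. indicator (box a c) x * f x) \<in> borel_measurable lebesgue"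
        "\<And>n. (\<lambda>x. box_bump a c n x * f x) \<in> borel_measurable lebesgue"
        using bm by (auto intro: borel_measurable_times)
    qed (use f in auto)
    then have "(LINT x|lebesgue. indicator (box a c) x * f x) = 0"
      using 0[OF box_bump_test_fun[OF sub]] by (simp add: int_S LIMSEQ_const_iff)
    moreover have "(LINT x|lebesgue. indicator (box a c) x * f x) = integral (box a c) f"
      using set_lebesgue_integral_eq_integral(2)[of "box a c" f] integrable_mult_indicator[OF _ f, of "box a c"]
      by (simp add: set_lebesgue_integral_def set_integrable_def)
    ultimately show ?thesis
      by (simp add: integral_open_interval)
  qed
  obtain N where N: "negligible N"
    and lim: "\<And>x e. \<lbrakk>x \<notin> N; 0 < e\<rbrakk> \<Longrightarrow> \<exists>d>0. \<forall>h. 0 < h \<and> h < d \<longrightarrow>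
      norm (integral (cbox x (x + h *\<^sub>R One)) f /\<^sub>R h ^ DIM('a) - f x) < e"
    using integrable_ccontinuous_explicit[OF f_cbox] by blast
  have "g x = 0" if x: "x \<in> S" "x \<notin> N" for x
  proof (rule ccontr)
    assume "g x \<noteq> 0"
    then obtain d where d: "d > 0" and small: "\<And>h. 0 < h \<Longrightarrow> h < d \<Longrightarrow>
        norm (integral (cbox x (x + h *\<^sub>R One)) f /\<^sub>R h ^ DIM('a) - f x) < norm (g x)"
      using lim[OF x(2), of "norm (g x)"] by auto
    obtain r where r: "r > 0" "ball x r \<subseteq> S"
      using S x(1) by (auto simp: open_contains_ball)
    \<comment> \<open>\<open>h < d\<close> keeps the average over the cube within
      \<open>norm (g x)\<close> of \<open>f x = g x\<close>. \<open>h * DIM('a) < r\<close> puts the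
      cube with corner \<open>x\<close> into the ball, since the norm is at most the sum of the
      absolute coordinates; the average is then 0, a contradiction.\<close>
    define h where "h = min (d / 2) (r / (2 * DIM('a)))"
    have h: "0 < h" "h < d" "h * DIM('a) < r"
      using d r(1) by (auto simp: h_def min_def field_simps)
    have "cbox x (x + h *\<^sub>R One) \<subseteq> ball x r"
    proof
      fix y assume y: "y \<in> cbox x (x + h *\<^sub>R One)"
      have "norm (y - x) \<le> (\<Sum>b\<in>Basis. \<bar>(y - x) \<bullet> b\<bar>)"
        by (rule norm_le_l1)
      also have "\<dots> \<le> (\<Sum>b\<in>(Basis :: 'a set). h)"
        using y h(1) by (intro sum_mono) (auto simp: mem_box inner_diff_left inner_add_left)
      also have "\<dots> < r" using h(3) by (simp add: mult.commute)
      finally show "y \<in> ball x r" by (simp add: dist_norm norm_minus_commute)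
    qed
    with r(2) have "integral (cbox x (x + h *\<^sub>R One)) f = 0"
      by (intro box0) auto
    with small[OF h(1,2)] x(1) show False by (simp add: f_def)
  qed
  then have "AE x in lebesgue. x \<in> S \<longrightarrow> g x = 0"
    using N by (intro AE_I'[of N]) (auto simp: negligible_iff_null_sets)
  then show ?thesis
    using S_leb by (subst AE_restrict_space_iff) auto
qed

section \<open>Square-integrable functions and their products\<close>

lemma L2_I [intro?]:
  "f \<in> borel_measurable M \<Longrightarrow> integrable M (\<lambda>x. (norm (f x))\<^sup>2) \<Longrightarrow> f \<in> L2 M"
  by (simp add: L2_def)

lemma L2_measurable: "f \<in> L2 M \<Longrightarrow> f \<in> borel_measurable M"
  and L2_integrable_power2: "f \<in> L2 M \<Longrightarrow> integrable M (\<lambda>x. (norm (f x))\<^sup>2)"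
  by (simp_all add: L2_def)

lemma L2_dominated:
  assumes "f \<in> L2 M" "g \<in> borel_measurable M" "\<And>x. x \<in> space M \<Longrightarrow> norm (g x) \<le> C * norm (f x)"
  shows "g \<in> L2 M"
proof (rule L2_I)
  show "integrable M (\<lambda>x. (norm (g x))\<^sup>2)"
  proof (rule Bochner_Integration.integrable_bound)
    show "integrable M (\<lambda>x. C\<^sup>2 * (norm (f x))\<^sup>2)"
      using assms(1) by (simp add: L2_integrable_power2)
    show "AE x in M. norm ((norm (g x))\<^sup>2) \<le> norm (C\<^sup>2 * (norm (f x))\<^sup>2)"
      using assms(3) by (intro AE_I2) (simp add: power_mult_distrib[symmetric] power_mono)
  qed (use assms(2) in simp)
qed fact

lemma L2_cong_AE:
  assumes f: "f \<in> L2 M" and g: "g \<in> borel_measurable M" and eq: "AE x in M. g x = f x"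
  shows "g \<in> L2 M"
proof (rule L2_I)
  have "integrable M (\<lambda>x. (norm (g x))\<^sup>2) \<longleftrightarrow> integrable M (\<lambda>x. (norm (f x))\<^sup>2)"
    using L2_measurable[OF f] g eq by (intro integrable_cong_AE) auto
  then show "integrable M (\<lambda>x. (norm (g x))\<^sup>2)"
    using L2_integrable_power2[OF f] by simp
qed fact

lemma L2_add:
  assumes f: "f \<in> L2 M" and g: "g \<in> L2 M"
  shows "(\<lambda>x. f x + g x) \<in> L2 M"
proof (rule L2_I)
  note [measurable] = L2_measurable[OF f] L2_measurable[OF g]
  show "(\<lambda>x. f x + g x) \<in> borel_measurable M" by measurable
  show "integrable M (\<lambda>x. (norm (f x + g x))\<^sup>2)"
  proof (rule Bochner_Integration.integrable_bound)
    show "integrable M (\<lambda>x. 2 * (norm (f x))\<^sup>2 + 2 * (norm (g x))\<^sup>2)"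
      using f g by (simp add: L2_integrable_power2)
    have "(norm (f x + g x))\<^sup>2 \<le> 2 * (norm (f x))\<^sup>2 + 2 * (norm (g x))\<^sup>2" for x
    proof -
      have "(norm (f x + g x))\<^sup>2 \<le> (norm (f x) + norm (g x))\<^sup>2"
        by (intro power_mono norm_triangle_ineq) simp
      then show ?thesis
        using sum_squares_bound[of "norm (f x)" "norm (g x)"] by (simp add: power2_sum)
    qed
    then show "AE x in M. norm ((norm (f x + g x))\<^sup>2) \<le> norm (2 * (norm (f x))\<^sup>2 + 2 * (norm (g x))\<^sup>2)"
      by (intro AE_I2) simp
  qed measurable
qed

lemma L2_minus: "f \<in> L2 M \<Longrightarrow> (\<lambda>x. - f x) \<in> L2 M"
  by (simp add: L2_def)

lemma L2_diff: "f \<in> L2 M \<Longrightarrow> g \<in> L2 M \<Longrightarrow> (\<lambda>x. f x - g x) \<in> L2 M"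
  using L2_add[OF _ L2_minus] by simp

lemma L2_sum: "(\<And>i. i \<in> I \<Longrightarrow> f i \<in> L2 M) \<Longrightarrow> (\<lambda>x. \<Sum>i\<in>I. f i x) \<in> L2 M"
  by (induction I rule: infinite_finite_induct) (simp_all add: L2_add, simp_all add: L2_def)

text \<open>Bounded factors occur in three shapes, treated here and in the next two lemmas: a
  coefficient times a field, a scalar trace times a vector such as the normal, and a vector trace
  paired with the normal.\<close>

lemma L2_scaleR_bounded:
  assumes a: "a \<in> borel_measurable M" "\<And>x. x \<in> space M \<Longrightarrow> \<bar>a x\<bar> \<le> C" and f: "f \<in> L2 M"
  shows "(\<lambda>x. a x *\<^sub>R f x) \<in> L2 M"
  using a L2_measurable[OF f]
  by (intro L2_dominated[OF f, of _ C]) (auto intro: mult_right_mono)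

lemma L2_scaleR_vector_bounded:
  assumes f: "f \<in> L2 M" and v: "v \<in> borel_measurable M" "\<And>x. x \<in> space M \<Longrightarrow> norm (v x) \<le> C"
  shows "(\<lambda>x. f x *\<^sub>R v x) \<in> L2 M"
  using v L2_measurable[OF f]
  by (intro L2_dominated[OF f, of _ C]) (auto simp: mult.commute[of "\<bar>f _\<bar>"] intro: mult_right_mono)

lemma L2_inner_bounded:
  assumes f: "f \<in> L2 M" and v: "v \<in> borel_measurable M" "\<And>x. x \<in> space M \<Longrightarrow> norm (v x) \<le> C"
  shows "(\<lambda>x. f x \<bullet> v x) \<in> L2 M"
proof (rule L2_dominated[OF f, of _ C])
  show "(\<lambda>x. f x \<bullet> v x) \<in> borel_measurable M"
    using v L2_measurable[OF f] by simp
  show "norm (f x \<bullet> v x) \<le> C * norm (f x)" if "x \<in> space M" for x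
    using Cauchy_Schwarz_ineq2[of "f x" "v x"] mult_left_mono[OF v(2)[OF that], of "norm (f x)"]
    by (simp add: mult.commute)
qed

lemma L2_inner_integrable:
  assumes f: "f \<in> L2 M" and g: "g \<in> L2 M"
  shows "integrable M (\<lambda>x. f x \<bullet> g x)"
proof (rule Bochner_Integration.integrable_bound)
  note [measurable] = L2_measurable[OF f] L2_measurable[OF g]
  show "integrable M (\<lambda>x. (norm (f x))\<^sup>2 + (norm (g x))\<^sup>2)"
    using f g by (simp add: L2_integrable_power2)
  have "\<bar>f x \<bullet> g x\<bar> \<le> (norm (f x))\<^sup>2 + (norm (g x))\<^sup>2" for x
    using Cauchy_Schwarz_ineq2[of "f x" "g x"] sum_squares_bound[of "norm (f x)" "norm (g x)"]
      mult_nonneg_nonneg[OF norm_ge_zero[of "f x"] norm_ge_zero[of "g x"]] by linarith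
  then show "AE x in M. norm (f x \<bullet> g x) \<le> norm ((norm (f x))\<^sup>2 + (norm (g x))\<^sup>2)"
    by (intro AE_I2) simp
  show "(\<lambda>x. f x \<bullet> g x) \<in> borel_measurable M" by measurable
qed

lemma (in finite_measure) L2_integrable:
  assumes f: "f \<in> L2 M"
  shows "integrable M f"
proof (rule Bochner_Integration.integrable_bound)
  show "integrable M (\<lambda>x. 1 + (norm (f x))\<^sup>2)"
    using f by (simp add: L2_integrable_power2)
  have "norm (f x) \<le> 1 + (norm (f x))\<^sup>2" for x
    using sum_squares_bound[of 1 "norm (f x)"] norm_ge_zero[of "f x"] unfolding power2_eq_square by linarith
  then show "AE x in M. norm (f x) \<le> norm (1 + (norm (f x))\<^sup>2)"
    by (intro AE_I2) simp
qed (rule L2_measurable[OF f])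

lemma L2_restrict_space_subset:
  assumes f: "f \<in> L2 (restrict_space M T)" and "S \<subseteq> T" "S \<in> sets M" "T \<in> sets M"
  shows "f \<in> L2 (restrict_space M S)"
proof -
  have "restrict_space M S = restrict_space (restrict_space M T) S"
    using assms sets.sets_into_space[of S M] by (subst restrict_restrict_space) (auto simp: Int_absorb1)
  moreover have "integrable (restrict_space (restrict_space M T) S) (\<lambda>x. (norm (f x))\<^sup>2)"
    using L2_integrable_power2[OF f] assms
    by (subst integrable_restrict_space)
       (auto intro!: integrable_mult_indicator[where 'b = real, simplified]
             simp: sets_restrict_space_iff space_restrict_space Int_absorb1)
  ultimately show ?thesis
    using L2_measurable[OF f] by (auto intro!: L2_I measurable_restrict_space1)
qed

text \<open>Every term of \<open>B_stab\<close> is reduced to this. The equation for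
  \<open>G\<close> is only almost everywhere because weak derivatives and traces are linear only in
  that sense; \<open>G \<in> L2 M\<close> gives the measurability needed to change the integrand on
  a null set.\<close>

lemma integral_inner_diff_right:
  assumes F: "F \<in> L2 M" and G: "G \<in> L2 M" "G1 \<in> L2 M" "G2 \<in> L2 M"
    and eq: "AE x in M. G x = G1 x - G2 x"
  shows "(LINT x|M. F x \<bullet> G x) = (LINT x|M. F x \<bullet> G1 x) - (LINT x|M. F x \<bullet> G2 x)"
proof -
  note [measurable] = L2_measurable[OF F] L2_measurable[OF G(1)] L2_measurable[OF G(2)]
    L2_measurable[OF G(3)]
  have "(LINT x|M. F x \<bullet> G x) = (LINT x|M. F x \<bullet> G1 x - F x \<bullet> G2 x)"
    by (rule integral_cong_AE) (use eq in \<open>auto simp: inner_diff_right\<close>)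
  also have "\<dots> = (LINT x|M. F x \<bullet> G1 x) - (LINT x|M. F x \<bullet> G2 x)"
    by (intro Bochner_Integration.integral_diff L2_inner_integrable F G)
  finally show ?thesis .
qed

section \<open>Linearity and uniqueness of weak derivatives\<close>

lemma is_weak_grad_grad: "\<phi> \<in> H1 S \<Longrightarrow> is_weak_grad S \<phi> (grad S \<phi>)"
  using someI_ex[of "is_weak_grad S \<phi>"] by (simp add: grad_def H1_def)

lemma is_weak_div_wdiv: "\<exists>d. is_weak_div S u d \<Longrightarrow> is_weak_div S u (wdiv S u)"
  using someI_ex[of "is_weak_div S u"] by (simp add: wdiv_def)

lemma finite_measure_lebesgue_on_bounded_open:
  "open S \<Longrightarrow> bounded S \<Longrightarrow> finite_measure (lebesgue_on S)"
  by (simp add: finite_measure_lebesgue_on lmeasurable_open)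

text \<open>Meant for a test function and its gradient: continuity on the whole space gives a bound
  on the compact closure of \<open>S\<close>, and the finite measure of \<open>S\<close> turns the
  bound into square integrability.\<close>

lemma L2_continuous:
  fixes a :: "'a::euclidean_space \<Rightarrow> 'b::euclidean_space"
  assumes S: "open S" "bounded S" and a: "continuous_on UNIV a"
  shows "a \<in> L2 (lebesgue_on S)" "a \<in> borel_measurable (lebesgue_on S)"
    "\<exists>C. \<forall>x\<in>S. norm (a x) \<le> C"
proof -
  interpret finite_measure "lebesgue_on S"
    by (rule finite_measure_lebesgue_on_bounded_open[OF S])
  have "bounded (a ` closure S)"
    using S(2) a by (intro compact_imp_bounded compact_continuous_image)
      (auto intro: continuous_on_subset)
  then obtain C where C: "\<And>x. x \<in> S \<Longrightarrow> norm (a x) \<le> C"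
    using closure_subset[of S] by (fastforce simp: bounded_iff)
  then show "\<exists>C. \<forall>x\<in>S. norm (a x) \<le> C" by blast
  have "a \<in> borel_measurable borel"
    using a by (rule borel_measurable_continuous_onI)
  then show meas: "a \<in> borel_measurable (lebesgue_on S)"
    by (simp add: measurable_restrict_space1 measurable_completion)
  have "(\<lambda>_. 1 :: real) \<in> L2 (lebesgue_on S)" by (simp add: L2_def)
  then show "a \<in> L2 (lebesgue_on S)"
    by (rule L2_dominated[OF _ meas, of _ C]) (use C in simp)
qed

context
  fixes S :: "'a::euclidean_space set"
  assumes S: "open S" "bounded S"
begin

interpretation finite_measure "lebesgue_on S"
  by (rule finite_measure_lebesgue_on_bounded_open[OF S])

text \<open>The integrals on both sides of the identities that define weak derivatives; their
  integrability is what allows two such identities to be subtracted.\<close>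

lemma weak_terms_integrable:
  fixes \<psi> :: "'a \<Rightarrow> real" and f :: "'a \<Rightarrow> 'b::euclidean_space"
  assumes "test_fun S \<psi>" and f: "f \<in> L2 (lebesgue_on S)"
  shows "integrable (lebesgue_on S) (\<lambda>x. \<psi> x *\<^sub>R f x)"
    "f' \<in> L2 (lebesgue_on S) \<Longrightarrow> integrable (lebesgue_on S) (\<lambda>x. f' x *\<^sub>R classical_grad \<psi> x)"
    "u \<in> L2 (lebesgue_on S) \<Longrightarrow> integrable (lebesgue_on S) (\<lambda>x. u x \<bullet> classical_grad \<psi> x)"
proof -
  have "smooth \<psi>" using assms(1) by (simp add: test_fun_def)
  note c = L2_continuous[OF S smooth_continuous_on[OF this]]
    L2_continuous[OF S classical_grad_continuous_on[OF this]]
  obtain C C' where C: "\<And>x. x \<in> S \<Longrightarrow> \<bar>\<psi> x\<bar> \<le> C" "\<And>x. x \<in> S \<Longrightarrow> norm (classical_grad \<psi> x) \<le> C'"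
    using c(3,6) by auto
  show "integrable (lebesgue_on S) (\<lambda>x. \<psi> x *\<^sub>R f x)"
    using C by (intro L2_integrable L2_scaleR_bounded c f) auto
  show "f' \<in> L2 (lebesgue_on S) \<Longrightarrow> integrable (lebesgue_on S) (\<lambda>x. f' x *\<^sub>R classical_grad \<psi> x)"
    using C by (intro L2_integrable L2_scaleR_vector_bounded c) auto
  show "u \<in> L2 (lebesgue_on S) \<Longrightarrow> integrable (lebesgue_on S) (\<lambda>x. u x \<bullet> classical_grad \<psi> x)"
    by (intro L2_inner_integrable c)
qed

lemma is_weak_grad_diff:
  assumes "\<phi> \<in> L2 (lebesgue_on S)" "\<phi>' \<in> L2 (lebesgue_on S)"
    and G: "is_weak_grad S \<phi> G" "is_weak_grad S \<phi>' G'"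
  shows "is_weak_grad S (\<lambda>x. \<phi> x - \<phi>' x) (\<lambda>x. G x - G' x)"
  unfolding is_weak_grad_def
proof (intro conjI allI impI)
  have L2: "G \<in> L2 (lebesgue_on S)" "G' \<in> L2 (lebesgue_on S)"
    using G by (auto simp: is_weak_grad_def)
  then show "(\<lambda>x. G x - G' x) \<in> L2 (lebesgue_on S)" by (rule L2_diff)
  fix \<psi> assume \<psi>: "test_fun S \<psi>"
  note int = weak_terms_integrable(1)[OF \<psi> L2(1)] weak_terms_integrable(1)[OF \<psi> L2(2)]
    weak_terms_integrable(2)[OF \<psi> L2(1) assms(1)] weak_terms_integrable(2)[OF \<psi> L2(1) assms(2)]
  show "(LINT x|lebesgue_on S. (\<phi> x - \<phi>' x) *\<^sub>R classical_grad \<psi> x) =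
      - (LINT x|lebesgue_on S. \<psi> x *\<^sub>R (G x - G' x))"
    using G \<psi> int by (simp add: is_weak_grad_def scaleR_diff_left scaleR_diff_right)
qed

lemma is_weak_div_diff:
  assumes "u \<in> L2 (lebesgue_on S)" "u' \<in> L2 (lebesgue_on S)"
    and "is_weak_div S u d" "is_weak_div S u' d'"
  shows "is_weak_div S (\<lambda>x. u x - u' x) (\<lambda>x. d x - d' x)"
  unfolding is_weak_div_def
proof (intro conjI allI impI)
  have L2: "d \<in> L2 (lebesgue_on S)" "d' \<in> L2 (lebesgue_on S)"
    using assms by (auto simp: is_weak_div_def)
  then show "(\<lambda>x. d x - d' x) \<in> L2 (lebesgue_on S)" by (rule L2_diff)
  fix \<psi> assume \<psi>: "test_fun S \<psi>"
  note int = weak_terms_integrable(1)[OF \<psi> L2(1)] weak_terms_integrable(1)[OF \<psi> L2(2)]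
    weak_terms_integrable(3)[OF \<psi> L2(1) assms(1)] weak_terms_integrable(3)[OF \<psi> L2(1) assms(2)]
  show "(LINT x|lebesgue_on S. (u x - u' x) \<bullet> classical_grad \<psi> x) =
      - (LINT x|lebesgue_on S. \<psi> x * (d x - d' x))"
    using assms(3,4) \<psi> int by (simp add: is_weak_div_def inner_diff_left right_diff_distrib)
qed

lemma is_weak_grad_unique:
  assumes G: "is_weak_grad S \<phi> G" "is_weak_grad S \<phi> G'"
  shows "AE x in lebesgue_on S. G x = G' x"
proof -
  have L2: "G \<in> L2 (lebesgue_on S)" "G' \<in> L2 (lebesgue_on S)"
    using G by (auto simp: is_weak_grad_def)
  \<comment> \<open>Separation by test functions is a statement on real functions, so it is applied
    to each component; the finitely many null sets are united afterwards.\<close>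
  have "AE x in lebesgue_on S. (G x - G' x) \<bullet> b = 0" for b
  proof (rule test_funs_separate[OF S(1)])
    show "integrable (lebesgue_on S) (\<lambda>x. (G x - G' x) \<bullet> b)"
      by (intro integrable_inner_left L2_integrable L2_diff L2)
    fix \<psi> assume \<psi>: "test_fun S \<psi>"
    have "(LINT x|lebesgue_on S. \<psi> x * ((G x - G' x) \<bullet> b)) =
        (LINT x|lebesgue_on S. (\<psi> x *\<^sub>R G x - \<psi> x *\<^sub>R G' x) \<bullet> b)"
      by (simp add: scaleR_diff_right[symmetric])
    also have "\<dots> = (LINT x|lebesgue_on S. \<psi> x *\<^sub>R G x - \<psi> x *\<^sub>R G' x) \<bullet> b"
      using weak_terms_integrable(1)[OF \<psi> L2(1)] weak_terms_integrable(1)[OF \<psi> L2(2)]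
      by (intro integral_inner_left) simp
    also have "(LINT x|lebesgue_on S. \<psi> x *\<^sub>R G x - \<psi> x *\<^sub>R G' x) = 0"
      using weak_terms_integrable(1)[OF \<psi> L2(1)] weak_terms_integrable(1)[OF \<psi> L2(2)] G \<psi>
      by (simp add: is_weak_grad_def)
    finally show "(LINT x|lebesgue_on S. \<psi> x * ((G x - G' x) \<bullet> b)) = 0" by simp
  qed
  then have "AE x in lebesgue_on S. \<forall>b\<in>Basis. (G x - G' x) \<bullet> b = 0"
    by (intro AE_finite_allI) auto
  then show ?thesis
    by eventually_elim (auto simp: inner_diff_left intro: euclidean_eqI)
qed

lemma is_weak_div_unique:
  assumes d: "is_weak_div S u d" "is_weak_div S u d'"
  shows "AE x in lebesgue_on S. d x = d' x"
proof -
  have L2: "d \<in> L2 (lebesgue_on S)" "d' \<in> L2 (lebesgue_on S)"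
    using d by (auto simp: is_weak_div_def)
  have "AE x in lebesgue_on S. d x - d' x = 0"
  proof (rule test_funs_separate[OF S(1)])
    show "integrable (lebesgue_on S) (\<lambda>x. d x - d' x)"
      by (intro L2_integrable L2_diff L2)
    fix \<psi> assume \<psi>: "test_fun S \<psi>"
    show "(LINT x|lebesgue_on S. \<psi> x * (d x - d' x)) = 0"
      using weak_terms_integrable(1)[OF \<psi> L2(1)] weak_terms_integrable(1)[OF \<psi> L2(2)] d \<psi>
      by (simp add: is_weak_div_def right_diff_distrib)
  qed
  then show ?thesis by simp
qed

lemma H1_diff: "\<phi> \<in> H1 S \<Longrightarrow> \<phi>' \<in> H1 S \<Longrightarrow> (\<lambda>x. \<phi> x - \<phi>' x) \<in> H1 S"
  unfolding H1_def using is_weak_grad_diff by (blast intro: L2_diff)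

lemma grad_diff:
  assumes "\<phi> \<in> H1 S" "\<phi>' \<in> H1 S"
  shows "AE x in lebesgue_on S. grad S (\<lambda>x. \<phi> x - \<phi>' x) x = grad S \<phi> x - grad S \<phi>' x"
proof (rule is_weak_grad_unique)
  show "is_weak_grad S (\<lambda>x. \<phi> x - \<phi>' x) (grad S (\<lambda>x. \<phi> x - \<phi>' x))"
    by (intro is_weak_grad_grad H1_diff assms)
  show "is_weak_grad S (\<lambda>x. \<phi> x - \<phi>' x) (\<lambda>x. grad S \<phi> x - grad S \<phi>' x)"
    using assms by (intro is_weak_grad_diff is_weak_grad_grad) (auto simp: H1_def)
qed

lemma wdiv_diff:
  assumes "u \<in> L2 (lebesgue_on S)" "u' \<in> L2 (lebesgue_on S)" "\<exists>d. is_weak_div S u d" "\<exists>d. is_weak_div S u' d"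
  shows "AE x in lebesgue_on S. wdiv S (\<lambda>x. u x - u' x) x = wdiv S u x - wdiv S u' x"
proof (rule is_weak_div_unique)
  show "is_weak_div S (\<lambda>x. u x - u' x) (wdiv S (\<lambda>x. u x - u' x))"
    using assms is_weak_div_diff by (intro is_weak_div_wdiv) blast
  show "is_weak_div S (\<lambda>x. u x - u' x) (\<lambda>x. wdiv S u x - wdiv S u' x)"
    using assms by (intro is_weak_div_diff is_weak_div_wdiv)
qed

end

lemma grad_L2: "\<phi> \<in> H1 S \<Longrightarrow> grad S \<phi> \<in> L2 (lebesgue_on S)"
  using is_weak_grad_grad by (auto simp: is_weak_grad_def)

lemma wdiv_L2: "\<exists>d. is_weak_div S u d \<Longrightarrow> wdiv S u \<in> L2 (lebesgue_on S)"
  using is_weak_div_wdiv by (auto simp: is_weak_div_def)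

section \<open>Surface measure and normals\<close>

lemma space_plane_measure [simp]: "space (plane_measure H) = UNIV"
  by (simp add: plane_measure_def)

lemma borel_subset_sets_plane_measure: "sets borel \<subseteq> sets (plane_measure H)"
  unfolding plane_measure_def by (auto intro: sets_completionI_sets)

text \<open>The bridge from Borel measurability to surfaces. Lebesgue measurability would not do:
  \<open>plane_measure H\<close> is concentrated on a Lebesgue-null set.\<close>

lemma measurable_plane_measure_restrict:
  assumes "f \<in> borel_measurable (restrict_space borel S)"
  shows "f \<in> borel_measurable (restrict_space (plane_measure H) S)"
proof -
  have "borel_measurable (restrict_space borel S) \<subseteq>
      (borel_measurable (restrict_space (plane_measure H) S) :: ('a \<Rightarrow> 'b) set)"
    using borel_subset_sets_plane_measure[of H]
    by (intro measurable_mono) (auto simp: sets_restrict_space space_restrict_space)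
  then show ?thesis using assms by auto
qed

text \<open>Measurability of \<open>T\<close> enters because \<open>emeasure\<close> is 0 on
  non-measurable sets, which would remove hyperplanes from \<open>planes T\<close>.\<close>

lemma planes_mono:
  assumes "S \<subseteq> T" "T \<in> sets borel"
  shows "planes S \<subseteq> planes T"
proof
  fix H assume "H \<in> planes S"
  moreover have "emeasure (plane_measure H) S \<le> emeasure (plane_measure H) T"
    using assms borel_subset_sets_plane_measure[of H] by (intro emeasure_mono) auto
  ultimately show "H \<in> planes T"
    by (auto simp: planes_def)
qed

text \<open>The vector-valued version of \<open>surf_L2\<close>: \<open>jump\<close> and
  \<open>tr_vec\<close> take values in the Euclidean space.\<close>

definition L2_on_surface :: "'a::euclidean_space set \<Rightarrow> ('a \<Rightarrow> 'b::euclidean_space) set" where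
  "L2_on_surface S = {f. \<forall>H\<in>planes S. f \<in> L2 (restrict_space (plane_measure H) S)}"

lemma surf_L2_eq: "surf_L2 S = L2_on_surface S"
  by (simp add: surf_L2_def L2_on_surface_def)

lemma L2_on_surface_mono:
  assumes f: "f \<in> L2_on_surface T" and sub: "S \<subseteq> T" "S \<in> sets borel" "T \<in> sets borel"
  shows "f \<in> L2_on_surface S"
  unfolding L2_on_surface_def
proof (intro CollectI ballI)
  fix H assume "H \<in> planes S"
  then have "H \<in> planes T" using planes_mono[OF sub(1,3)] by auto
  then have "f \<in> L2 (restrict_space (plane_measure H) T)"
    using f by (simp add: L2_on_surface_def)
  then show "f \<in> L2 (restrict_space (plane_measure H) S)"
    by (rule L2_restrict_space_subset) (use sub borel_subset_sets_plane_measure[of H] in auto)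
qed

lemma surf_AE_mono:
  assumes "surf_AE T P" "S \<subseteq> T" "T \<in> sets borel"
  shows "surf_AE S P"
  unfolding surf_AE_def
proof
  fix H assume "H \<in> planes S"
  then have "AE x in plane_measure H. x \<in> T \<longrightarrow> P x"
    using planes_mono[OF assms(2,3)] assms(1) by (auto simp: surf_AE_def)
  then show "AE x in plane_measure H. x \<in> S \<longrightarrow> P x"
    by eventually_elim (use assms(2) in auto)
qed

lemma surf_AE_mp:
  assumes "surf_AE S P" "surf_AE S Q" "\<And>x. x \<in> S \<Longrightarrow> P x \<Longrightarrow> Q x \<Longrightarrow> R x"
  shows "surf_AE S R"
  unfolding surf_AE_def
proof
  fix H assume "H \<in> planes S"
  then have "AE x in plane_measure H. x \<in> S \<longrightarrow> P x" "AE x in plane_measure H. x \<in> S \<longrightarrow> Q x"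
    using assms(1,2) by (auto simp: surf_AE_def)
  then show "AE x in plane_measure H. x \<in> S \<longrightarrow> R x"
    by eventually_elim (use assms(3) in auto)
qed

lemma surf_AE_imp: "surf_AE S P \<Longrightarrow> (\<And>x. x \<in> S \<Longrightarrow> P x \<Longrightarrow> Q x) \<Longrightarrow> surf_AE S Q"
  by (rule surf_AE_mp)

lemma surf_AE_finite_ball:
  assumes "finite I" "\<And>i. i \<in> I \<Longrightarrow> surf_AE S (P i)"
  shows "surf_AE S (\<lambda>x. \<forall>i\<in>I. P i x)"
  unfolding surf_AE_def
proof
  fix H assume "H \<in> planes S"
  then have "AE x in plane_measure H. \<forall>i\<in>I. x \<in> S \<longrightarrow> P i x"
    using assms by (intro AE_finite_allI) (auto simp: surf_AE_def)
  then show "AE x in plane_measure H. x \<in> S \<longrightarrow> (\<forall>i\<in>I. P i x)"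
    by eventually_elim auto
qed

lemma surf_int_inner_diff_right:
  fixes F :: "'a::euclidean_space \<Rightarrow> 'b::euclidean_space"
  assumes S: "S \<in> sets borel" and F: "F \<in> L2_on_surface S"
    and G: "G \<in> L2_on_surface S" "G1 \<in> L2_on_surface S" "G2 \<in> L2_on_surface S"
    and eq: "surf_AE S (\<lambda>x. G x = G1 x - G2 x)"
  shows "surf_int S (\<lambda>x. F x \<bullet> G x) = surf_int S (\<lambda>x. F x \<bullet> G1 x) - surf_int S (\<lambda>x. F x \<bullet> G2 x)"
  \<comment> \<open>The rule also covers an infinite \<open>planes S\<close>, where all three sums
    are 0 by convention.\<close>
  unfolding surf_int_def sum_subtractf[symmetric]
proof (rule sum.cong)
  fix H assume H: "H \<in> planes S"
  have S': "S \<in> sets (plane_measure H)"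
    using S borel_subset_sets_plane_measure[of H] by auto
  then have *: "set_lebesgue_integral (plane_measure H) S f = (LINT x|restrict_space (plane_measure H) S. f x)"
    for f :: "'a \<Rightarrow> real"
    by (subst integral_restrict_space) (auto simp: set_lebesgue_integral_def)
  show "(LINT x:S|plane_measure H. F x \<bullet> G x) =
      (LINT x:S|plane_measure H. F x \<bullet> G1 x) - (LINT x:S|plane_measure H. F x \<bullet> G2 x)"
    unfolding *
  proof (rule integral_inner_diff_right)
    show "AE x in restrict_space (plane_measure H) S. G x = G1 x - G2 x"
      using eq H S' by (subst AE_restrict_space_iff) (auto simp: surf_AE_def)
  qed (use H F G in \<open>auto simp: L2_on_surface_def\<close>)
qed simp

section \<open>Outward normals and the flat part of the boundary\<close>

lemma is_normal_unique:
  assumes "is_normal \<omega> x n" "is_normal \<omega> x n'"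
  shows "n = n'"
proof (rule ccontr)
  assume "n \<noteq> n'"
  obtain r r' where r: "r > 0" "\<And>y. y \<in> ball x r \<Longrightarrow> y \<in> \<omega> \<longleftrightarrow> n \<bullet> (y - x) < 0"
    and r': "r' > 0" "\<And>y. y \<in> ball x r' \<Longrightarrow> y \<in> \<omega> \<longleftrightarrow> n' \<bullet> (y - x) < 0"
    and norm: "norm n = 1" "norm n' = 1"
    using assms unfolding is_normal_def by blast
  have unit: "n \<bullet> n = 1" "n' \<bullet> n' = 1"
    using norm by (simp_all add: norm_eq_1)
  have "(n - n') \<bullet> (n - n') > 0"
    using \<open>n \<noteq> n'\<close> by (simp only: inner_gt_zero_iff right_minus_eq not_False_eq_True)
  then have lt: "n \<bullet> n' < 1"
    using unit by (simp add: inner_diff_left inner_diff_right inner_commute)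
  \<comment> \<open>A step along \<open>n' - n\<close> enters the half-space of \<open>n\<close> and
    leaves that of \<open>n'\<close>, because \<open>n \<bullet> n' < 1\<close>. As
    \<open>norm (n' - n) \<le> 2\<close>, the divisor 4 keeps the step within half of the smaller
    radius.\<close>
  define e where "e = min r r' / 4"
  define y where "y = x + e *\<^sub>R (n' - n)"
  have e: "e > 0" using r r' by (simp add: e_def)
  have "norm (n' - n) \<le> 2"
    using norm_triangle_ineq4[of n' n] norm by simp
  then have "dist x y \<le> e * 2"
    using e by (simp add: y_def dist_norm)
  also have "\<dots> < min r r'" using r(1) r'(1) by (simp add: e_def min_def)
  finally have "y \<in> ball x r" "y \<in> ball x r'" by auto
  then have "n \<bullet> (y - x) < 0 \<longleftrightarrow> n' \<bullet> (y - x) < 0"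
    using r r' by blast
  moreover have "n \<bullet> (y - x) = e * (n \<bullet> n' - 1)" "n' \<bullet> (y - x) = e * (1 - n \<bullet> n')"
    using unit by (simp_all add: y_def inner_diff_right inner_commute)
  ultimately show False
    using lt e by (simp add: mult_less_0_iff)
qed

lemma normal_eq: "is_normal \<omega> x n \<Longrightarrow> normal \<omega> x = n"
  unfolding normal_def using is_normal_unique by blast

lemma norm_normal: "x \<in> bdry \<omega> \<Longrightarrow> norm (normal \<omega> x) = 1"
proof -
  assume "x \<in> bdry \<omega>"
  then obtain n where "is_normal \<omega> x n" by (auto simp: bdry_def)
  then show ?thesis by (simp add: normal_eq) (simp add: is_normal_def)
qed

text \<open>Near \<open>x\<close> the set is an open half-ball. Points on the flat side inherit the
  normal with a smaller radius. A point off it has no normal: on the inner side it belongs to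
  \<omega>, which a point with a normal never does; on the outer side a whole neighbourhood misses
  \<omega>, while a step against a normal would enter it.\<close>

lemma bdry_locally_hyperplane:
  assumes "x \<in> bdry \<omega>"
  shows "\<exists>n r. r > 0 \<and> (\<forall>y\<in>ball x r. y \<in> bdry \<omega> \<longleftrightarrow> n \<bullet> (y - x) = 0) \<and>
    (\<forall>y\<in>ball x r \<inter> bdry \<omega>. normal \<omega> y = n)"
proof -
  obtain n r where n: "norm n = 1" and r: "r > 0"
    and \<omega>: "\<And>y. y \<in> ball x r \<Longrightarrow> y \<in> \<omega> \<longleftrightarrow> n \<bullet> (y - x) < 0"
    using assms unfolding bdry_def is_normal_def by blast
  have normal_n: "is_normal \<omega> y n" if y: "y \<in> ball x r" "n \<bullet> (y - x) = 0" for y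
  proof -
    have "\<forall>z\<in>ball y (r - dist x y). z \<in> \<omega> \<longleftrightarrow> n \<bullet> (z - y) < 0"
    proof
      fix z assume "z \<in> ball y (r - dist x y)"
      then have "z \<in> ball x r"
        using dist_triangle[of x z y] by simp
      then show "z \<in> \<omega> \<longleftrightarrow> n \<bullet> (z - y) < 0"
        using \<omega> y(2) by (simp add: inner_diff_right)
    qed
    then show ?thesis
      using n y(1) unfolding is_normal_def by (intro conjI exI[of _ "r - dist x y"]) auto
  qed
  have zero: "n \<bullet> (y - x) = 0" if y: "y \<in> ball x r" "y \<in> bdry \<omega>" for y
  proof (rule ccontr)
    assume "n \<bullet> (y - x) \<noteq> 0"
    obtain m s where m: "norm m = 1" and s: "s > 0"
      and \<omega>': "\<And>z. z \<in> ball y s \<Longrightarrow> z \<in> \<omega> \<longleftrightarrow> m \<bullet> (z - y) < 0"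
      using y(2) unfolding bdry_def is_normal_def by blast
    have "\<not> n \<bullet> (y - x) < 0"
      using \<omega>'[of y] \<omega>[OF y(1)] s by simp
    with \<open>n \<bullet> (y - x) \<noteq> 0\<close> have "y \<in> {z. n \<bullet> (z - x) > 0} \<inter> ball x r"
      using y(1) by simp
    moreover have "open ({z. n \<bullet> (z - x) > 0} \<inter> ball x r)"
      by (intro open_Int open_Collect_less open_ball continuous_intros)
    ultimately obtain t where t: "t > 0" "ball y t \<subseteq> {z. n \<bullet> (z - x) > 0} \<inter> ball x r"
      by (meson openE)
    define e where "e = min s t / 2"
    have e: "e > 0" "e < s" "e < t" using s t by (auto simp: e_def min_def)
    have "y - e *\<^sub>R m \<in> \<omega>"
      using \<omega>'[of "y - e *\<^sub>R m"] e m by (simp add: dist_norm norm_eq_1)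
    moreover have "y - e *\<^sub>R m \<in> ball y t"
      using e m by (simp add: dist_norm)
    ultimately show False
      using t(2) \<omega> by fastforce
  qed
  show ?thesis
  proof (intro exI[of _ n] exI[of _ r] conjI ballI)
    show "y \<in> bdry \<omega> \<longleftrightarrow> n \<bullet> (y - x) = 0" if "y \<in> ball x r" for y
      using zero[OF that] normal_n[OF that] unfolding bdry_def by blast
    show "normal \<omega> y = n" if "y \<in> ball x r \<inter> bdry \<omega>" for y
      using that by (intro normal_eq normal_n zero) auto
  qed (rule r)
qed

text \<open>The definition is an uncountable union over normals and radii. By the local description
  the set is locally closed, hence the intersection of its closure with an open set.\<close>

lemma bdry_borel [measurable]: "bdry \<omega> \<in> sets borel"
proof -
  have "\<exists>U. open U \<and> x \<in> U \<and> closure (bdry \<omega>) \<inter> U \<subseteq> bdry \<omega>" if x: "x \<in> bdry \<omega>" for x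
  proof -
    obtain n r where r: "r > 0" and n: "\<forall>y\<in>ball x r. y \<in> bdry \<omega> \<longleftrightarrow> n \<bullet> (y - x) = 0"
      using bdry_locally_hyperplane[OF x] by blast
    have "ball x r \<inter> closure (bdry \<omega>) \<subseteq> closure (ball x r \<inter> bdry \<omega>)"
      by (intro open_Int_closure_subset open_ball)
    also have "\<dots> \<subseteq> {y. n \<bullet> (y - x) = 0}"
      using n by (intro closure_minimal closed_Collect_eq continuous_intros) auto
    finally have "closure (bdry \<omega>) \<inter> ball x r \<subseteq> bdry \<omega>"
      using n by auto
    then show ?thesis using r by (intro exI[of _ "ball x r"]) auto
  qed
  then obtain U where U: "\<And>x. x \<in> bdry \<omega> \<Longrightarrow> open (U x) \<and> x \<in> U x \<and> closure (bdry \<omega>) \<inter> U x \<subseteq> bdry \<omega>"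
    by metis
  then have "bdry \<omega> = closure (bdry \<omega>) \<inter> (\<Union>x\<in>bdry \<omega>. U x)"
    using closure_subset[of "bdry \<omega>"] by blast
  also have "\<dots> \<in> sets borel"
    using U by (intro sets.Int borel_closed borel_open open_UN closed_closure) auto
  finally show ?thesis .
qed

text \<open>The normal is locally constant on \<open>bdry \<omega>\<close>, hence continuous
  there.\<close>

lemma normal_measurable: "normal \<omega> \<in> borel_measurable (restrict_space borel (bdry \<omega>))"
proof (rule borel_measurable_continuous_on_restrict)
  show "continuous_on (bdry \<omega>) (normal \<omega>)"
    unfolding continuous_on_eq_continuous_within
  proof
    fix x assume x: "x \<in> bdry \<omega>"
    obtain n r where r: "r > 0" and n: "\<forall>y\<in>ball x r \<inter> bdry \<omega>. normal \<omega> y = n"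
      using bdry_locally_hyperplane[OF x] by blast
    have "continuous (at x within bdry \<omega>) (\<lambda>_. n)" by simp
    then show "continuous (at x within bdry \<omega>) (normal \<omega>)"
      by (rule continuous_transform_within[OF _ r x]) (use n in \<open>simp add: dist_commute\<close>)
  qed
qed

section \<open>Traces\<close>

lemma integrable_lebesgue_on_subset:
  fixes f :: "'a::euclidean_space \<Rightarrow> 'b::euclidean_space"
  assumes "integrable (lebesgue_on T) f" "S \<subseteq> T" "S \<in> sets lebesgue" "T \<in> sets lebesgue"
  shows "integrable (lebesgue_on S) f"
proof -
  have "integrable lebesgue (\<lambda>x. indicator T x *\<^sub>R f x)"
    using assms(1,4) by (simp add: integrable_restrict_space)
  then have "integrable lebesgue (\<lambda>x. indicator S x *\<^sub>R indicator T x *\<^sub>R f x)"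
    by (rule integrable_mult_indicator[OF assms(3)])
  also have "(\<lambda>x. indicator S x *\<^sub>R indicator T x *\<^sub>R f x) = (\<lambda>x. indicat_real S x *\<^sub>R f x)"
    using assms(2) by (intro ext) (auto simp: indicator_def)
  finally show ?thesis
    using assms(3) by (simp add: integrable_restrict_space)
qed

text \<open>Left continuity of \<open>h\<close> reduces the Cauchy criterion to rational radii, which makes the
  existence of the trace a measurable property.\<close>

lemma convergent_at_right_0_iff:
  fixes h :: "real \<Rightarrow> real"
  assumes left: "\<And>r. r > 0 \<Longrightarrow> (h \<longlongrightarrow> h r) (at_left r)"
  shows "(\<exists>l. (h \<longlongrightarrow> l) (at_right 0)) \<longleftrightarrow>
    (\<forall>n. \<exists>k. \<forall>p q. 0 < p \<and> real_of_rat p < inverse (real (Suc k)) \<and> 0 < q \<and> real_of_rat q < inverse (real (Suc k)) \<longrightarrow>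
      \<bar>h (real_of_rat p) - h (real_of_rat q)\<bar> \<le> inverse (real (Suc n)))"
  (is "?lhs \<longleftrightarrow> ?rhs")
proof
  assume ?lhs
  then obtain l where l: "(h \<longlongrightarrow> l) (at_right 0)" ..
  show ?rhs
  proof
    fix n
    have "\<forall>\<^sub>F r in at_right 0. dist (h r) l < inverse (real (Suc n)) / 2"
      by (rule tendstoD[OF l]) simp
    then obtain d where d: "d > 0" "\<And>r. 0 < r \<Longrightarrow> r < d \<Longrightarrow> dist (h r) l < inverse (real (Suc n)) / 2"
      by (auto simp: eventually_at_right_field)
    obtain k where k: "inverse (real (Suc k)) < d"
      using reals_Archimedean[OF d(1)] by blast
    have "\<bar>h r - h s\<bar> \<le> inverse (real (Suc n))"
      if "0 < r" "r < inverse (real (Suc k))" "0 < s" "s < inverse (real (Suc k))" for r s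
    proof -
      have "dist (h r) l < inverse (real (Suc n)) / 2" "dist (h s) l < inverse (real (Suc n)) / 2"
        by (intro d(2); use that k in linarith)+
      then show ?thesis
        using dist_triangle_half_l[of "h r" l "inverse (real (Suc n))" "h s"]
        by (simp add: dist_commute dist_real_def)
    qed
    then show "\<exists>k. \<forall>p q. 0 < p \<and> real_of_rat p < inverse (real (Suc k)) \<and> 0 < q \<and> real_of_rat q < inverse (real (Suc k)) \<longrightarrow>
        \<bar>h (real_of_rat p) - h (real_of_rat q)\<bar> \<le> inverse (real (Suc n))"
      by (intro exI[of _ k]) simp
  qed
next
  assume R: ?rhs
  \<comment> \<open>Extends the bound from rational to real \<open>r\<close>: a violation at
    \<open>r\<close> would persist on an interval to the left of \<open>r\<close>, by left
    continuity, and that interval contains a rational radius.\<close>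
  have real_radius: "\<bar>h r - h (real_of_rat q)\<bar> \<le> e"
    if e: "\<And>p q. 0 < p \<Longrightarrow> real_of_rat p < d \<Longrightarrow> 0 < q \<Longrightarrow> real_of_rat q < d \<Longrightarrow> \<bar>h (real_of_rat p) - h (real_of_rat q)\<bar> \<le> e"
      and r: "0 < r" "r < d" and q: "0 < q" "real_of_rat q < d" for r d e :: real and q :: rat
  proof (rule ccontr)
    assume "\<not> \<bar>h r - h (real_of_rat q)\<bar> \<le> e"
    moreover have "((\<lambda>s. \<bar>h s - h (real_of_rat q)\<bar>) \<longlongrightarrow> \<bar>h r - h (real_of_rat q)\<bar>) (at_left r)"
      by (intro tendsto_intros left r)
    ultimately have "\<forall>\<^sub>F s in at_left r. \<bar>h s - h (real_of_rat q)\<bar> > e"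
      by (intro order_tendstoD) auto
    then obtain b where b: "b < r" "\<And>s. b < s \<Longrightarrow> s < r \<Longrightarrow> \<bar>h s - h (real_of_rat q)\<bar> > e"
      by (auto simp: eventually_at_left_field)
    \<comment> \<open>The maximum with 0 keeps the rational radius positive, as the hypothesis
      \<open>e\<close> demands.\<close>
    obtain p where p: "max b 0 < real_of_rat p" "real_of_rat p < r"
      using of_rat_dense[of "max b 0" r] b(1) r(1) by auto
    then have "\<bar>h (real_of_rat p) - h (real_of_rat q)\<bar> \<le> e"
      using r q by (intro e) auto
    with b(2)[of "real_of_rat p"] p show False by simp
  qed
  \<comment> \<open>The radii 1/(j+1) are rational, so the criterion makes \<open>a\<close> a Cauchy
    sequence; its limit is the candidate for the limit of \<open>h\<close>.\<close>
  define a where "a j = h (inverse (real (Suc j)))" for j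
  have inv_rat: "real_of_rat (inverse (of_nat (Suc j))) = inverse (real (Suc j))" for j
    by (simp only: of_rat_inverse of_rat_of_nat_eq)
  have inv_less: "inverse (real (Suc j)) < inverse (real (Suc k))" if "Suc k \<le> j" for j k
    using that by (intro less_imp_inverse_less) simp_all
  have a_rat: "a j = h (of_rat (inverse (of_nat (Suc j))))" for j
    by (simp only: a_def inv_rat)
  have "Cauchy a"
  proof (rule metric_CauchyI)
    fix e :: real assume "e > 0"
    then obtain n where n: "inverse (real (Suc n)) < e" using reals_Archimedean by blast
    obtain k where k: "\<And>p q. 0 < p \<Longrightarrow> real_of_rat p < inverse (real (Suc k)) \<Longrightarrow> 0 < q \<Longrightarrow> real_of_rat q < inverse (real (Suc k)) \<Longrightarrow>
        \<bar>h (real_of_rat p) - h (real_of_rat q)\<bar> \<le> inverse (real (Suc n))"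
      using R by blast
    have "dist (a i) (a j) < e" if "i \<ge> Suc k" "j \<ge> Suc k" for i j
    proof -
      have "\<bar>a i - a j\<bar> \<le> inverse (real (Suc n))"
        unfolding a_rat using inv_less[OF that(1)] inv_less[OF that(2)]
        by (intro k) (simp_all only: inv_rat, simp_all)
      then show ?thesis using n by (simp add: dist_real_def)
    qed
    then show "\<exists>M. \<forall>i\<ge>M. \<forall>j\<ge>M. dist (a i) (a j) < e" by blast
  qed
  then obtain l where l: "a \<longlonglongrightarrow> l"
    using Cauchy_convergent convergentD by blast
  have "(h \<longlongrightarrow> l) (at_right 0)"
  proof (rule tendstoI)
    fix e :: real assume "e > 0"
    then obtain n where n: "inverse (real (Suc n)) < e" using reals_Archimedean by blast
    obtain k where k: "\<And>p q. 0 < p \<Longrightarrow> real_of_rat p < inverse (real (Suc k)) \<Longrightarrow> 0 < q \<Longrightarrow> real_of_rat q < inverse (real (Suc k)) \<Longrightarrow>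
        \<bar>h (real_of_rat p) - h (real_of_rat q)\<bar> \<le> inverse (real (Suc n))"
      using R by blast
    \<comment> \<open>Compare \<open>h r\<close> with \<open>a j\<close> and let \<open>j\<close>
      grow. The bound is non-strict to survive this limit; strictness returns through the choice of
      \<open>n\<close>.\<close>
    have "\<bar>h r - l\<bar> \<le> inverse (real (Suc n))" if r: "0 < r" "r < inverse (real (Suc k))" for r
    proof (rule tendsto_upperbound)
      show "((\<lambda>j. \<bar>h r - a j\<bar>) \<longlongrightarrow> \<bar>h r - l\<bar>) sequentially"
        by (intro tendsto_intros l)
      show "\<forall>\<^sub>F j in sequentially. \<bar>h r - a j\<bar> \<le> inverse (real (Suc n))"
        unfolding eventually_sequentially
      proof (intro exI[of _ "Suc k"] allI impI)
        fix j assume "Suc k \<le> j"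
        then show "\<bar>h r - a j\<bar> \<le> inverse (real (Suc n))"
          unfolding a_rat using r inv_less[OF \<open>Suc k \<le> j\<close>]
          by (intro real_radius[OF k]) (simp_all only: inv_rat, simp_all)
      qed
    qed simp
    then have "dist (h r) l < e" if "0 < r" "r < inverse (real (Suc k))" for r
      using that n by (fastforce simp: dist_real_def)
    then show "\<forall>\<^sub>F r in at_right 0. dist (h r) l < e"
      unfolding eventually_at_right_field by (intro exI[of _ "inverse (real (Suc k))"]) auto
  qed
  then show ?lhs ..
qed

section \<open>Mean values over balls as functions of centre and radius\<close>

lemma ball_integral_measurable:
  fixes g :: "'a::euclidean_space \<Rightarrow> real"
  assumes g [measurable]: "g \<in> borel_measurable borel"
  shows "(\<lambda>x. LINT y|lborel. indicator (ball x r) y * g y) \<in> borel_measurable borel"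
proof -
  \<comment> \<open>Joint measurability in centre and point holds because the pairs at distance less
    than \<open>r\<close> form an open set; Fubini then gives measurability in the centre.\<close>
  have "(\<lambda>(x, y). indicator (ball x r) y * g y) =
      (\<lambda>z. indicator {z. dist (fst z) (snd z) < r} z * g (snd z))"
    by (auto simp: indicator_def)
  moreover have "{z :: 'a \<times> 'a. dist (fst z) (snd z) < r} \<in> sets borel"
    by (intro borel_open open_Collect_less continuous_intros)
  then have "(\<lambda>z :: 'a \<times> 'a. indicator {z. dist (fst z) (snd z) < r} z * g (snd z)) \<in> borel_measurable (borel \<Otimes>\<^sub>M lborel)"
    by (intro borel_measurable_times borel_measurable_indicator)
       (auto simp: borel_prod[symmetric] cong: sets_pair_measure_cong)
  ultimately show ?thesis
    by (intro lborel.borel_measurable_lebesgue_integral) simp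
qed

text \<open>An open ball is the union of its smaller concentric balls, so the indicators converge at
  every point when the radius increases to \<open>r\<close>. From the right the limit would be the
  closed ball.\<close>

lemma ball_integral_left_continuous:
  fixes g :: "'a::euclidean_space \<Rightarrow> real"
  assumes g: "integrable lborel g" and r: "r > 0"
  shows "((\<lambda>r. LINT y|lborel. indicator (ball x r) y * g y) \<longlongrightarrow>
    (LINT y|lborel. indicator (ball x r) y * g y)) (at_left r)"
proof (rule tendsto_at_left_sequentially[OF r])
  fix R :: "nat \<Rightarrow> real"
  assume R: "\<And>n. R n < r" "R \<longlonglongrightarrow> r"
  have [measurable]: "g \<in> borel_measurable borel" using g by (simp add: integrable_iff_bounded)
  show "(\<lambda>n. LINT y|lborel. indicator (ball x (R n)) y * g y) \<longlonglongrightarrow>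
      (LINT y|lborel. indicator (ball x r) y * g y)"
  proof (rule integral_dominated_convergence[where w = "\<lambda>y. norm (g y)"])
    show "AE y in lborel. (\<lambda>n. indicator (ball x (R n)) y * g y) \<longlonglongrightarrow> indicator (ball x r) y * g y"
    proof (intro AE_I2 tendsto_mult tendsto_const)
      fix y
      show "(\<lambda>n. indicator (ball x (R n)) y) \<longlonglongrightarrow> (indicator (ball x r) y :: real)"
      proof (cases "dist x y < r")
        case True
        then have "\<forall>\<^sub>F n in sequentially. dist x y < R n"
          by (rule order_tendstoD[OF R(2)])
        then have "\<forall>\<^sub>F n in sequentially. indicator (ball x (R n)) y = (1 :: real)"
          by eventually_elim simp
        with True show ?thesis by (simp add: tendsto_eventually)
      next
        case False
        have "indicator (ball x (R n)) y = (0 :: real)" for n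
          using False R(1)[of n] by (auto simp: indicator_def)
        with False show ?thesis by simp
      qed
    qed
  qed (use g in \<open>auto simp: indicator_def\<close>)
qed

context
  fixes \<omega> :: "'a::euclidean_space set"
  assumes \<omega>: "open \<omega>" "bounded \<omega>"
begin

lemma measure_Int_ball:
  "measure lebesgue (\<omega> \<inter> ball x r) = (LINT y|lborel. indicator (ball x r) y * indicator \<omega> y)"
proof -
  have "measure lebesgue (\<omega> \<inter> ball x r) = (LINT y|lborel. indicator (\<omega> \<inter> ball x r) y)"
    using \<omega> by simp
  also have "\<dots> = (LINT y|lborel. indicator (ball x r) y * indicator \<omega> y)"
    by (intro Bochner_Integration.integral_cong) (auto simp: indicator_def)
  finally show ?thesis .
qed

text \<open>\<open>f\<close> is only Lebesgue measurable on \<omega>. Replacing its zero extension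
  by a Borel function changes it on a null set, hence no mean value, and makes the two lemmas on
  ball integrals applicable.\<close>

lemma mean_val_ball_integrals:
  assumes f: "integrable (lebesgue_on \<omega>) f"
  obtains g where "integrable lborel g"
    "\<And>x r. mean_val \<omega> f x r =
      (LINT y|lborel. indicator (ball x r) y * g y) / (LINT y|lborel. indicator (ball x r) y * indicator \<omega> y)"
proof -
  have \<omega>_leb: "\<omega> \<in> sets lebesgue" using \<omega>(1) by simp
  have int: "integrable lebesgue (\<lambda>y. indicator \<omega> y * f y)"
    using f \<omega>_leb by (simp add: integrable_restrict_space)
  then obtain g where g: "g \<in> borel_measurable lborel" and eq: "AE y in lborel. indicator \<omega> y * f y = g y"
    using completion_ex_borel_measurable_real[of "\<lambda>y. indicator \<omega> y * f y" lborel] by auto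
  have "integrable lebesgue g"
    using int g AE_completion[OF eq] by (subst integrable_cong_AE[symmetric]) (auto intro: measurable_completion)
  with g have int_g: "integrable lborel g" by (simp add: integrable_completion)
  have "(LINT y|lebesgue_on (\<omega> \<inter> ball x r). f y) = (LINT y|lborel. indicator (ball x r) y * g y)" for x r
  proof -
    have "(LINT y|lebesgue_on (\<omega> \<inter> ball x r). f y) = (LINT y|lebesgue. indicator (ball x r) y * (indicator \<omega> y * f y))"
      using \<omega>_leb by (subst integral_restrict_space)
        (auto simp: indicator_inter_arith mult_ac intro!: Bochner_Integration.integral_cong)
    also have "\<dots> = (LINT y|lebesgue. indicator (ball x r) y * g y)"
    proof (rule integral_cong_AE)
      have "indicator (ball x r) \<in> borel_measurable lebesgue"
        by (intro borel_measurable_indicator) simp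
      then show "(\<lambda>y. indicator (ball x r) y * (indicator \<omega> y * f y)) \<in> borel_measurable lebesgue"
        "(\<lambda>y. indicator (ball x r) y * g y) \<in> borel_measurable lebesgue"
        using borel_measurable_integrable[OF int] measurable_completion[OF g]
        by (auto simp only: intro!: borel_measurable_times)
      show "AE y in lebesgue. indicator (ball x r) y * (indicator \<omega> y * f y) = indicator (ball x r) y * g y"
        using AE_completion[OF eq] by eventually_elim simp
    qed
    also have "\<dots> = (LINT y|lborel. indicator (ball x r) y * g y)"
      using g by (intro integral_completion borel_measurable_times borel_measurable_indicator) auto
    finally show ?thesis .
  qed
  then show thesis
    by (intro that[OF int_g]) (simp add: mean_val_def measure_Int_ball)
qed

lemma integrable_indicator_lborel: "integrable lborel (indicator \<omega> :: 'a \<Rightarrow> real)"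
  using \<omega> emeasure_bounded_finite[of \<omega>] by (simp add: integrable_indicator_iff)

lemma mean_val_measurable:
  assumes f: "integrable (lebesgue_on \<omega>) f"
  shows "(\<lambda>x. mean_val \<omega> f x r) \<in> borel_measurable borel"
proof -
  obtain g where g: "integrable lborel g" "\<And>x r. mean_val \<omega> f x r =
      (LINT y|lborel. indicator (ball x r) y * g y) / (LINT y|lborel. indicator (ball x r) y * indicator \<omega> y)"
    using mean_val_ball_integrals[OF f] by blast
  show ?thesis
    unfolding g(2) using g(1) integrable_indicator_lborel
    by (intro borel_measurable_divide ball_integral_measurable) (auto dest: borel_measurable_integrable)
qed

lemma mean_val_left_continuous:
  assumes f: "integrable (lebesgue_on \<omega>) f" and r: "r > 0"
  shows "(mean_val \<omega> f x \<longlongrightarrow> mean_val \<omega> f x r) (at_left r)"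
proof (cases "measure lebesgue (\<omega> \<inter> ball x r) = 0")
  case True
  \<comment> \<open>If the ball of radius \<open>r\<close> meets \<omega> in a null set, so do the
    smaller ones, and division by zero makes all these mean values 0.\<close>
  have "mean_val \<omega> f x s = 0" if "s \<le> r" for s
  proof -
    have "measure lebesgue (\<omega> \<inter> ball x s) \<le> measure lebesgue (\<omega> \<inter> ball x r)"
      using that \<omega> by (intro measure_mono_fmeasurable) (auto intro!: lmeasurable_open bounded_Int)
    with True show ?thesis
      by (simp add: mean_val_def measure_le_0_iff)
  qed
  moreover have "\<forall>\<^sub>F s in at_left r. s \<le> r"
    by (auto simp: eventually_at_filter)
  ultimately have "\<forall>\<^sub>F s in at_left r. mean_val \<omega> f x s = mean_val \<omega> f x r"
    by (auto elim: eventually_mono)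
  then show ?thesis by (rule tendsto_eventually)
next
  case False
  then have nz: "(LINT y|lborel. indicator (ball x r) y * indicator \<omega> y) \<noteq> (0 :: real)"
    by (simp add: measure_Int_ball)
  obtain g where g: "integrable lborel g" "\<And>x r. mean_val \<omega> f x r =
      (LINT y|lborel. indicator (ball x r) y * g y) / (LINT y|lborel. indicator (ball x r) y * indicator \<omega> y)"
    using mean_val_ball_integrals[OF f] by blast
  have eq: "mean_val \<omega> f x = (\<lambda>r. (LINT y|lborel. indicator (ball x r) y * g y) /
      (LINT y|lborel. indicator (ball x r) y * indicator \<omega> y))"
    by (rule ext) (rule g(2))
  show ?thesis
    unfolding eq using nz
    by (intro tendsto_divide ball_integral_left_continuous g(1) r integrable_indicator_lborel)
qed

lemma tr_measurable:
  assumes f: "integrable (lebesgue_on \<omega>) f"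
  shows "tr \<omega> f \<in> borel_measurable borel"
proof -
  have [measurable]: "(\<lambda>x. mean_val \<omega> f x r) \<in> borel_measurable borel" for r
    by (rule mean_val_measurable[OF f])
  define C where "C x \<longleftrightarrow> (\<forall>n. \<exists>k. \<forall>p q. 0 < p \<and> real_of_rat p < inverse (real (Suc k)) \<and> 0 < q \<and> real_of_rat q < inverse (real (Suc k)) \<longrightarrow>
      \<bar>mean_val \<omega> f x (real_of_rat p) - mean_val \<omega> f x (real_of_rat q)\<bar> \<le> inverse (real (Suc n)))" for x
  have [measurable]: "Measurable.pred borel C"
    unfolding C_def by measurable
  have C: "(\<exists>l. (mean_val \<omega> f x \<longlongrightarrow> l) (at_right 0)) \<longleftrightarrow> C x" for x
    unfolding C_def by (rule convergent_at_right_0_iff[OF mean_val_left_continuous[OF f]])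
  \<comment> \<open>Where the limit exists it may be taken along the radii 1/(n+1). Elsewhere no
    \<open>l\<close> satisfies the predicate behind \<open>Lim\<close>, so the value is the same
    constant at all such points.\<close>
  have "tr \<omega> f x = (if C x then lim (\<lambda>n. mean_val \<omega> f x (inverse (real (Suc n)))) else (THE l. False))" for x
  proof (cases "C x")
    case True
    then obtain l where l: "(mean_val \<omega> f x \<longlongrightarrow> l) (at_right 0)"
      using C by blast
    have "filterlim (\<lambda>n. inverse (real (Suc n))) (at_right 0) sequentially"
      using LIMSEQ_inverse_real_of_nat by (auto simp: filterlim_at intro!: always_eventually)
    with l have "(\<lambda>n. mean_val \<omega> f x (inverse (real (Suc n)))) \<longlonglongrightarrow> l"
      by (rule filterlim_compose)
    with True l show ?thesis
      by (simp add: tr_def tendsto_Lim limI)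
  next
    case False
    then have "\<not> (mean_val \<omega> f x \<longlongrightarrow> l) (at_right 0)" for l
      using C by blast
    with False show ?thesis by (simp add: tr_def t2_space_class.Lim_def)
  qed
  then have "tr \<omega> f = (\<lambda>x. if C x then lim (\<lambda>n. mean_val \<omega> f x (inverse (real (Suc n)))) else (THE l. False))"
    by (rule ext)
  then show ?thesis by simp
qed

lemma tr_bounded:
  assumes f: "integrable (lebesgue_on \<omega>) f" and C: "\<And>y. y \<in> \<omega> \<Longrightarrow> \<bar>f y\<bar> \<le> C"
  shows "\<exists>C. \<forall>x. \<bar>tr \<omega> f x\<bar> \<le> C"
proof (intro exI allI)
  fix x
  \<comment> \<open>The maximum with 0 is for an empty \<omega>, where \<open>C\<close> may be
    negative while every mean value is 0.\<close>
  have mean: "\<bar>mean_val \<omega> f x r\<bar> \<le> max C 0" for r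
  proof -
    have fin: "\<omega> \<inter> ball x r \<in> lmeasurable"
      using \<omega> by (intro lmeasurable_open bounded_Int) auto
    have "\<bar>LINT y|lebesgue_on (\<omega> \<inter> ball x r). f y\<bar> \<le> (LINT y|lebesgue_on (\<omega> \<inter> ball x r). max C 0)"
    proof (rule integral_abs_bound_integral)
      show "integrable (lebesgue_on (\<omega> \<inter> ball x r)) f"
        by (rule integrable_lebesgue_on_subset[OF f]) (use \<omega> in auto)
      interpret finite_measure "lebesgue_on (\<omega> \<inter> ball x r)"
        using fin by (rule finite_measure_lebesgue_on)
      show "integrable (lebesgue_on (\<omega> \<inter> ball x r)) (\<lambda>y. max C 0)" by simp
      show "\<And>y. y \<in> space (lebesgue_on (\<omega> \<inter> ball x r)) \<Longrightarrow> \<bar>f y\<bar> \<le> max C 0"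
        using C by fastforce
    qed
    also have "\<dots> = max C 0 * measure lebesgue (\<omega> \<inter> ball x r)"
      using fin by (simp add: measure_restrict_space fmeasurable_def)
    finally have "\<bar>LINT y|lebesgue_on (\<omega> \<inter> ball x r). f y\<bar> \<le> max C 0 * measure lebesgue (\<omega> \<inter> ball x r)" .
    then show ?thesis
      by (cases "measure lebesgue (\<omega> \<inter> ball x r) = 0")
         (auto simp: mean_val_def field_simps abs_divide zero_less_measure_iff divide_le_eq)
  qed
  \<comment> \<open>The second entry bounds the default value of \<open>Lim\<close> at points
    without a limit.\<close>
  show "\<bar>tr \<omega> f x\<bar> \<le> max (max C 0) \<bar>THE l. False\<bar>"
  proof (cases "\<exists>l. (mean_val \<omega> f x \<longlongrightarrow> l) (at_right 0)")
    case True
    then obtain l where l: "(mean_val \<omega> f x \<longlongrightarrow> l) (at_right 0)" ..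
    have "\<bar>l\<bar> \<le> max C 0"
      by (rule tendsto_upperbound[OF tendsto_rabs[OF l]]) (use mean in auto)
    with l show ?thesis by (simp add: tr_def tendsto_Lim)
  next
    case False
    then show ?thesis by (simp add: tr_def t2_space_class.Lim_def)
  qed
qed

text \<open>Mean values are exactly linear, traces only where both limits exist: the default value
  of \<open>Lim\<close> is not additive. Square integrability passes to the trace of the difference
  by almost everywhere equality, its Borel measurability coming from
  \<open>tr_measurable\<close>.\<close>

lemma has_trace_diff:
  assumes f: "integrable (lebesgue_on \<omega>) f" "has_trace \<omega> f"
    and g: "integrable (lebesgue_on \<omega>) g" "has_trace \<omega> g"
  shows "has_trace \<omega> (\<lambda>x. f x - g x)"
    and "surf_AE (bdry \<omega>) (\<lambda>x. tr \<omega> (\<lambda>x. f x - g x) x = tr \<omega> f x - tr \<omega> g x)"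
proof -
  have int: "integrable (lebesgue_on (\<omega> \<inter> ball x r)) h" if "integrable (lebesgue_on \<omega>) h"
    for x r and h :: "'a \<Rightarrow> real"
    by (rule integrable_lebesgue_on_subset[OF that]) (use \<omega> in auto)
  have "mean_val \<omega> (\<lambda>x. f x - g x) x = (\<lambda>r. mean_val \<omega> f x r - mean_val \<omega> g x r)" for x
    using f(1) g(1) int by (simp add: mean_val_def fun_eq_iff diff_divide_distrib)
  then have lim: "(mean_val \<omega> (\<lambda>x. f x - g x) x \<longlongrightarrow> l - l') (at_right 0)"
    if "(mean_val \<omega> f x \<longlongrightarrow> l) (at_right 0)" "(mean_val \<omega> g x \<longlongrightarrow> l') (at_right 0)" for x l l'
    using tendsto_diff[OF that] by simp
  have ex: "surf_AE (bdry \<omega>) (\<lambda>x. \<exists>l. (mean_val \<omega> f x \<longlongrightarrow> l) (at_right 0))"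
    "surf_AE (bdry \<omega>) (\<lambda>x. \<exists>l. (mean_val \<omega> g x \<longlongrightarrow> l) (at_right 0))"
    using f(2) g(2) by (auto simp: has_trace_def)
  show eq: "surf_AE (bdry \<omega>) (\<lambda>x. tr \<omega> (\<lambda>x. f x - g x) x = tr \<omega> f x - tr \<omega> g x)"
  proof (rule surf_AE_mp[OF ex])
    fix x
    assume "\<exists>l. (mean_val \<omega> f x \<longlongrightarrow> l) (at_right 0)" "\<exists>l. (mean_val \<omega> g x \<longlongrightarrow> l) (at_right 0)"
    then obtain l l' where l: "(mean_val \<omega> f x \<longlongrightarrow> l) (at_right 0)" "(mean_val \<omega> g x \<longlongrightarrow> l') (at_right 0)"
      by blast
    show "tr \<omega> (\<lambda>x. f x - g x) x = tr \<omega> f x - tr \<omega> g x"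
      using l lim[OF l] by (simp add: tr_def tendsto_Lim)
  qed
  show "has_trace \<omega> (\<lambda>x. f x - g x)"
    unfolding has_trace_def
  proof
    show "surf_AE (bdry \<omega>) (\<lambda>x. \<exists>l. (mean_val \<omega> (\<lambda>x. f x - g x) x \<longlongrightarrow> l) (at_right 0))"
      by (rule surf_AE_mp[OF ex]) (use lim in blast)
    have "tr \<omega> (\<lambda>x. f x - g x) \<in> L2 (restrict_space (plane_measure H) (bdry \<omega>))"
      if H: "H \<in> planes (bdry \<omega>)" for H
    proof (rule L2_cong_AE)
      show "(\<lambda>x. tr \<omega> f x - tr \<omega> g x) \<in> L2 (restrict_space (plane_measure H) (bdry \<omega>))"
        using f(2) g(2) H by (intro L2_diff) (auto simp: has_trace_def surf_L2_def)
      show "tr \<omega> (\<lambda>x. f x - g x) \<in> borel_measurable (restrict_space (plane_measure H) (bdry \<omega>))"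
        using f(1) g(1)
        by (intro measurable_plane_measure_restrict measurable_restrict_space1 tr_measurable) simp
      show "AE x in restrict_space (plane_measure H) (bdry \<omega>). tr \<omega> (\<lambda>x. f x - g x) x = tr \<omega> f x - tr \<omega> g x"
        using eq H borel_subset_sets_plane_measure[of H]
        by (subst AE_restrict_space_iff) (auto simp: surf_AE_def)
    qed
    then show "tr \<omega> (\<lambda>x. f x - g x) \<in> surf_L2 (bdry \<omega>)"
      by (simp add: surf_L2_def)
  qed
qed

end

section \<open>Linearity of the stabilized form\<close>

lemma L2_on_surface_sum:
  "(\<And>i. i \<in> I \<Longrightarrow> f i \<in> L2_on_surface S) \<Longrightarrow> (\<lambda>x. \<Sum>i\<in>I. f i x) \<in> L2_on_surface S"
  by (auto simp: L2_on_surface_def intro!: L2_sum)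

lemma L2_on_surface_scaleR_bounded:
  assumes "a \<in> borel_measurable (restrict_space borel S)" "\<And>x. x \<in> S \<Longrightarrow> \<bar>a x\<bar> \<le> C" "f \<in> L2_on_surface S"
  shows "(\<lambda>x. a x *\<^sub>R f x) \<in> L2_on_surface S"
  using assms unfolding L2_on_surface_def
  by (auto intro!: L2_scaleR_bounded[where C = C] measurable_plane_measure_restrict simp: space_restrict_space)

lemma L2_on_surface_scaleR_vector_bounded:
  assumes "f \<in> L2_on_surface S" "v \<in> borel_measurable (restrict_space borel S)" "\<And>x. x \<in> S \<Longrightarrow> norm (v x) \<le> C"
  shows "(\<lambda>x. f x *\<^sub>R v x) \<in> L2_on_surface S"
  using assms unfolding L2_on_surface_def
  by (auto intro!: L2_scaleR_vector_bounded[where C = C] measurable_plane_measure_restrict simp: space_restrict_space)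

lemma L2_on_surface_inner_bounded:
  assumes "f \<in> L2_on_surface S" "v \<in> borel_measurable (restrict_space borel S)" "\<And>x. x \<in> S \<Longrightarrow> norm (v x) \<le> C"
  shows "(\<lambda>x. f x \<bullet> v x) \<in> L2_on_surface S"
  using assms unfolding L2_on_surface_def
  by (auto intro!: L2_inner_bounded[where C = C] measurable_plane_measure_restrict simp: space_restrict_space)

lemma normal_measurable_subset:
  "S \<subseteq> bdry \<omega> \<Longrightarrow> normal \<omega> \<in> borel_measurable (restrict_space borel S)"
  using normal_measurable by (rule measurable_restrict_mono)

text \<open>The property of the elements on which the lemmas on weak derivatives and traces
  rely.\<close>

definition bounded_open_elements :: "'a::euclidean_space set set \<Rightarrow> bool" where
  "bounded_open_elements \<T> \<longleftrightarrow> (\<forall>\<omega>\<in>\<T>. open \<omega> \<and> bounded \<omega>)"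

lemma is_mesh_bounded_open_elements:
  assumes "is_mesh \<Omega> \<T>"
  shows "bounded_open_elements \<T>"
  unfolding bounded_open_elements_def
proof
  fix \<omega> assume "\<omega> \<in> \<T>"
  then have "open_polyhedron \<omega>"
    using assms by (simp add: is_mesh_def)
  then obtain \<P> where \<P>: "finite \<P>" "\<forall>P\<in>\<P>. polytope P" "\<omega> = interior (\<Union>\<P>)"
    unfolding open_polyhedron_def by metis
  have "\<forall>P\<in>\<P>. bounded P"
    using \<P>(2) polytope_imp_bounded by blast
  with \<P>(1) have "bounded (\<Union>\<P>)"
    by (intro bounded_Union)
  then show "open \<omega> \<and> bounded \<omega>"
    unfolding \<P>(3) using bounded_subset[OF _ interior_subset] by auto
qed

text \<open>The regularity of a single pressure in \<open>pres_space\<close>. Unlike the mean-value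
  condition on pairs, it is preserved by differences.\<close>

definition broken_H1 :: "'a::euclidean_space set set \<Rightarrow> ('a \<Rightarrow> real) set" where
  "broken_H1 \<T> = {p. \<forall>\<omega>\<in>\<T>. p \<in> H1 \<omega> \<and> has_trace \<omega> p}"

lemma edge_elements:
  assumes "e \<in> int_edges \<T>"
  shows "e \<subseteq> \<T>" "finite e"
  using assms by (auto simp: int_edges_def)

lemma edge_pts_subset: "\<omega> \<in> e \<Longrightarrow> edge_pts e \<subseteq> bdry \<omega>"
  by (auto simp: edge_pts_def)

lemma edge_pts_borel: "e \<in> int_edges \<T> \<Longrightarrow> edge_pts e \<in> sets borel"
  unfolding edge_pts_def by (intro sets.finite_INT) (auto simp: int_edges_def)

section \<open>Traces, averages and jumps of elementwise fields\<close>

context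
  fixes \<T> :: "'a::euclidean_space set set"
  assumes \<T>: "bounded_open_elements \<T>"
begin

lemma element_open_bounded: "\<omega> \<in> \<T> \<Longrightarrow> open \<omega>" "\<omega> \<in> \<T> \<Longrightarrow> bounded \<omega>"
  using \<T> by (auto simp: bounded_open_elements_def)

lemma broken_H1_L2: "p \<in> broken_H1 \<T> \<Longrightarrow> \<omega> \<in> \<T> \<Longrightarrow> p \<in> L2 (lebesgue_on \<omega>)"
  by (auto simp: broken_H1_def H1_def)

lemma broken_H1_integrable:
  assumes "p \<in> broken_H1 \<T>" "\<omega> \<in> \<T>"
  shows "integrable (lebesgue_on \<omega>) p"
proof -
  interpret finite_measure "lebesgue_on \<omega>"
    using assms by (intro finite_measure_lebesgue_on_bounded_open element_open_bounded)
  show ?thesis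
    using assms by (intro L2_integrable broken_H1_L2)
qed

lemma broken_H1_diff:
  assumes "p \<in> broken_H1 \<T>" "p' \<in> broken_H1 \<T>"
  shows "(\<lambda>x. p x - p' x) \<in> broken_H1 \<T>"
proof -
  have "(\<lambda>x. p x - p' x) \<in> H1 \<omega> \<and> has_trace \<omega> (\<lambda>x. p x - p' x)" if \<omega>: "\<omega> \<in> \<T>" for \<omega>
  proof
    show "(\<lambda>x. p x - p' x) \<in> H1 \<omega>"
      using assms \<omega> by (intro H1_diff element_open_bounded) (auto simp: broken_H1_def)
    show "has_trace \<omega> (\<lambda>x. p x - p' x)"
      using assms \<omega> by (intro has_trace_diff(1) element_open_bounded broken_H1_integrable) (auto simp: broken_H1_def)
  qed
  then show ?thesis by (simp add: broken_H1_def)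
qed

lemma vel_space_component: "u \<in> vel_space \<T> \<Longrightarrow> b \<in> Basis \<Longrightarrow> (\<lambda>x. u x \<bullet> b) \<in> broken_H1 \<T>"
  by (auto simp: vel_space_def broken_H1_def)

lemma vel_space_diff:
  assumes u: "u \<in> vel_space \<T>" "u' \<in> vel_space \<T>"
  shows "(\<lambda>x. u x - u' x) \<in> vel_space \<T>"
proof -
  have "(\<lambda>x. u x - u' x) \<in> L2 (lebesgue_on \<omega>)" if "\<omega> \<in> \<T>" for \<omega>
    using u that by (intro L2_diff) (auto simp: vel_space_def)
  moreover have "\<exists>d. is_weak_div \<omega> (\<lambda>x. u x - u' x) d" if "\<omega> \<in> \<T>" for \<omega>
    using u that is_weak_div_diff[OF element_open_bounded[OF that]] unfolding vel_space_def by blast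
  moreover have "(\<lambda>x. (u x - u' x) \<bullet> b) \<in> broken_H1 \<T>" if "b \<in> Basis" for b
    using broken_H1_diff[OF vel_space_component[OF u(1) that] vel_space_component[OF u(2) that]]
    by (simp add: inner_diff_left)
  ultimately show ?thesis
    by (simp add: vel_space_def broken_H1_def)
qed

lemma tr_L2:
  assumes "p \<in> broken_H1 \<T>" "\<omega> \<in> \<T>" "S \<subseteq> bdry \<omega>" "S \<in> sets borel"
  shows "tr \<omega> p \<in> L2_on_surface S"
proof -
  have "tr \<omega> p \<in> L2_on_surface (bdry \<omega>)"
    using assms by (auto simp: broken_H1_def has_trace_def surf_L2_eq)
  then show ?thesis
    by (rule L2_on_surface_mono) (use assms in auto)
qed

lemma tr_diff:
  assumes "p \<in> broken_H1 \<T>" "p' \<in> broken_H1 \<T>" "\<omega> \<in> \<T>" "S \<subseteq> bdry \<omega>"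
  shows "surf_AE S (\<lambda>x. tr \<omega> (\<lambda>x. p x - p' x) x = tr \<omega> p x - tr \<omega> p' x)"
proof (rule surf_AE_mono)
  show "surf_AE (bdry \<omega>) (\<lambda>x. tr \<omega> (\<lambda>x. p x - p' x) x = tr \<omega> p x - tr \<omega> p' x)"
    using assms by (intro has_trace_diff(2) element_open_bounded broken_H1_integrable) (auto simp: broken_H1_def)
qed (use assms in auto)

lemma tr_vec_L2:
  assumes "u \<in> vel_space \<T>" "\<omega> \<in> \<T>" "S \<subseteq> bdry \<omega>" "S \<in> sets borel"
  shows "tr_vec \<omega> u \<in> L2_on_surface S"
  unfolding tr_vec_def[abs_def]
  by (intro L2_on_surface_sum L2_on_surface_scaleR_vector_bounded[where C = 1] tr_L2
        vel_space_component assms) auto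

lemma tr_vec_diff:
  assumes u: "u \<in> vel_space \<T>" "u' \<in> vel_space \<T>" and "\<omega> \<in> \<T>" "S \<subseteq> bdry \<omega>"
  shows "surf_AE S (\<lambda>x. tr_vec \<omega> (\<lambda>x. u x - u' x) x = tr_vec \<omega> u x - tr_vec \<omega> u' x)"
proof -
  have "surf_AE S (\<lambda>x. \<forall>b\<in>Basis. tr \<omega> (\<lambda>x. u x \<bullet> b - u' x \<bullet> b) x = tr \<omega> (\<lambda>x. u x \<bullet> b) x - tr \<omega> (\<lambda>x. u' x \<bullet> b) x)"
    by (intro surf_AE_finite_ball tr_diff vel_space_component assms) auto
  then show ?thesis
    by (rule surf_AE_imp) (simp add: tr_vec_def inner_diff_left scaleR_diff_left sum_subtractf)
qed

text \<open>Trace and normal may belong to different sets: on interior edges both come from the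
  element, on the outer boundary the normal is that of the domain.\<close>

lemma normal_trace_L2:
  assumes "u \<in> vel_space \<T>" "\<omega> \<in> \<T>" "S \<subseteq> bdry \<omega>" "S \<in> sets borel" "S \<subseteq> bdry \<omega>'"
  shows "(\<lambda>x. tr_vec \<omega> u x \<bullet> normal \<omega>' x) \<in> L2_on_surface S"
  using assms norm_normal[of _ \<omega>']
  by (intro L2_on_surface_inner_bounded[where C = 1] tr_vec_L2 normal_measurable_subset) auto

lemma avg_L2:
  assumes p: "p \<in> broken_H1 \<T>" and e: "e \<in> int_edges \<T>"
  shows "avg e p \<in> L2_on_surface (edge_pts e)"
proof -
  have "(\<lambda>x. (1 / 2) *\<^sub>R (\<Sum>\<omega>\<in>e. tr \<omega> p x)) \<in> L2_on_surface (edge_pts e)"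
    using edge_elements[OF e]
    by (intro L2_on_surface_scaleR_bounded[where C = "1 / 2"] L2_on_surface_sum tr_L2 p edge_pts_subset
          edge_pts_borel[OF e]) auto
  then show ?thesis by (simp add: avg_def[abs_def])
qed

lemma jump_L2:
  assumes p: "p \<in> broken_H1 \<T>" and e: "e \<in> int_edges \<T>"
  shows "jump e p \<in> L2_on_surface (edge_pts e)"
  unfolding jump_def[abs_def]
proof (intro L2_on_surface_sum L2_on_surface_scaleR_vector_bounded[where C = 1])
  fix \<omega> assume \<omega>: "\<omega> \<in> e"
  then have sub: "edge_pts e \<subseteq> bdry \<omega>" by (rule edge_pts_subset)
  show "tr \<omega> p \<in> L2_on_surface (edge_pts e)"
    using \<omega> sub edge_elements[OF e] by (intro tr_L2 p edge_pts_borel[OF e]) auto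
  show "normal \<omega> \<in> borel_measurable (restrict_space borel (edge_pts e))"
    using sub by (rule normal_measurable_subset)
  show "norm (normal \<omega> x) \<le> 1" if "x \<in> edge_pts e" for x
    using sub that norm_normal[of x \<omega>] by auto
qed

lemma jump_vec_L2:
  assumes u: "u \<in> vel_space \<T>" and e: "e \<in> int_edges \<T>"
  shows "jump_vec e u \<in> L2_on_surface (edge_pts e)"
  unfolding jump_vec_def[abs_def]
  using edge_elements[OF e]
  by (intro L2_on_surface_sum normal_trace_L2 u edge_pts_subset edge_pts_borel[OF e]) auto

text \<open>An edge has two elements, so their exceptional null sets combine into one, which serves
  averages and jumps alike.\<close>

lemma edge_traces_diff:
  assumes p: "p \<in> broken_H1 \<T>" "p' \<in> broken_H1 \<T>" and e: "e \<in> int_edges \<T>"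
  shows "surf_AE (edge_pts e) (\<lambda>x. \<forall>\<omega>\<in>e. tr \<omega> (\<lambda>x. p x - p' x) x = tr \<omega> p x - tr \<omega> p' x)"
  using edge_elements[OF e] by (intro surf_AE_finite_ball tr_diff p edge_pts_subset) auto

lemma avg_diff:
  assumes "p \<in> broken_H1 \<T>" "p' \<in> broken_H1 \<T>" "e \<in> int_edges \<T>"
  shows "surf_AE (edge_pts e) (\<lambda>x. avg e (\<lambda>x. p x - p' x) x = avg e p x - avg e p' x)"
  using edge_traces_diff[OF assms]
  by (rule surf_AE_imp) (simp add: avg_def sum_subtractf diff_divide_distrib)

lemma jump_diff:
  assumes "p \<in> broken_H1 \<T>" "p' \<in> broken_H1 \<T>" "e \<in> int_edges \<T>"
  shows "surf_AE (edge_pts e) (\<lambda>x. jump e (\<lambda>x. p x - p' x) x = jump e p x - jump e p' x)"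
  using edge_traces_diff[OF assms]
  by (rule surf_AE_imp) (simp add: jump_def sum_subtractf scaleR_diff_left)

lemma jump_vec_diff:
  assumes u: "u \<in> vel_space \<T>" "u' \<in> vel_space \<T>" and e: "e \<in> int_edges \<T>"
  shows "surf_AE (edge_pts e) (\<lambda>x. jump_vec e (\<lambda>x. u x - u' x) x = jump_vec e u x - jump_vec e u' x)"
proof -
  have "surf_AE (edge_pts e) (\<lambda>x. \<forall>\<omega>\<in>e. tr_vec \<omega> (\<lambda>x. u x - u' x) x = tr_vec \<omega> u x - tr_vec \<omega> u' x)"
    using edge_elements[OF e] by (intro surf_AE_finite_ball tr_vec_diff u edge_pts_subset) auto
  then show ?thesis
    by (rule surf_AE_imp) (simp add: jump_vec_def sum_subtractf inner_diff_left)
qed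

text \<open>Drag and mobility carry no Sobolev regularity, so \<open>avg_L2\<close> does not apply
  to them; their averages enter as bounded Borel multipliers instead.\<close>

lemma avg_bounded_coefficient:
  assumes e: "e \<in> int_edges \<T>"
    and a: "\<forall>\<omega>\<in>\<T>. a \<in> borel_measurable (lebesgue_on \<omega>)"
    and bound: "\<forall>\<omega>\<in>\<T>. \<forall>x\<in>\<omega>. \<bar>a x\<bar> \<le> C"
  shows "avg e a \<in> borel_measurable borel" "\<exists>C. \<forall>x. \<bar>avg e a x\<bar> \<le> C"
proof -
  have int: "integrable (lebesgue_on \<omega>) a" if \<omega>: "\<omega> \<in> \<T>" for \<omega>
  proof -
    interpret finite_measure "lebesgue_on \<omega>"
      using \<omega> by (intro finite_measure_lebesgue_on_bounded_open element_open_bounded)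
    show ?thesis
      using a bound \<omega> by (intro integrable_const_bound[where B = C]) auto
  qed
  show "avg e a \<in> borel_measurable borel"
    unfolding avg_def[abs_def] using edge_elements[OF e] int
    by (intro borel_measurable_divide borel_measurable_sum tr_measurable element_open_bounded) auto
  have "\<exists>K. \<forall>x. \<bar>tr \<omega> a x\<bar> \<le> K" if "\<omega> \<in> e" for \<omega>
    using that edge_elements[OF e] int bound
    by (intro tr_bounded[where C = C] element_open_bounded) auto
  then obtain K where K: "\<And>\<omega> x. \<omega> \<in> e \<Longrightarrow> \<bar>tr \<omega> a x\<bar> \<le> K \<omega>"
    by metis
  have "\<bar>avg e a x\<bar> \<le> (\<Sum>\<omega>\<in>e. K \<omega>) / 2" for x
    using order_trans[OF sum_abs sum_mono[OF K]] by (simp add: avg_def)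
  then show "\<exists>C. \<forall>x. \<bar>avg e a x\<bar> \<le> C" by blast
qed

end

section \<open>Linearity of the volume, edge and boundary products\<close>

lemma vol_ip_diff_right:
  assumes "\<And>\<omega>. \<omega> \<in> \<T> \<Longrightarrow> F \<omega> \<in> L2 (lebesgue_on \<omega>)" "\<And>\<omega>. \<omega> \<in> \<T> \<Longrightarrow> G \<omega> \<in> L2 (lebesgue_on \<omega>)"
    "\<And>\<omega>. \<omega> \<in> \<T> \<Longrightarrow> G1 \<omega> \<in> L2 (lebesgue_on \<omega>)" "\<And>\<omega>. \<omega> \<in> \<T> \<Longrightarrow> G2 \<omega> \<in> L2 (lebesgue_on \<omega>)"
    "\<And>\<omega>. \<omega> \<in> \<T> \<Longrightarrow> AE x in lebesgue_on \<omega>. G \<omega> x = G1 \<omega> x - G2 \<omega> x"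
  shows "vol_ip \<T> F G = vol_ip \<T> F G1 - vol_ip \<T> F G2"
  unfolding vol_ip_def sum_subtractf[symmetric]
  by (intro sum.cong refl integral_inner_diff_right assms)

lemma edge_ip_diff_right:
  assumes "\<And>e. e \<in> int_edges \<T> \<Longrightarrow> F e \<in> L2_on_surface (edge_pts e)"
    "\<And>e. e \<in> int_edges \<T> \<Longrightarrow> G e \<in> L2_on_surface (edge_pts e)"
    "\<And>e. e \<in> int_edges \<T> \<Longrightarrow> G1 e \<in> L2_on_surface (edge_pts e)"
    "\<And>e. e \<in> int_edges \<T> \<Longrightarrow> G2 e \<in> L2_on_surface (edge_pts e)"
    "\<And>e. e \<in> int_edges \<T> \<Longrightarrow> surf_AE (edge_pts e) (\<lambda>x. G e x = G1 e x - G2 e x)"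
  shows "edge_ip \<T> F G = edge_ip \<T> F G1 - edge_ip \<T> F G2"
  unfolding edge_ip_def sum_subtractf[symmetric]
  by (intro sum.cong refl surf_int_inner_diff_right edge_pts_borel assms)

lemma bdry_ip_diff_right:
  fixes \<Omega> \<Gamma> :: "'a::euclidean_space set"
  defines "S \<omega> \<equiv> \<Gamma> \<inter> bdry \<Omega> \<inter> bdry \<omega>"
  assumes "\<Gamma> \<in> sets borel"
    "\<And>\<omega>. \<omega> \<in> \<T> \<Longrightarrow> F \<omega> \<in> L2_on_surface (S \<omega>)" "\<And>\<omega>. \<omega> \<in> \<T> \<Longrightarrow> G \<omega> \<in> L2_on_surface (S \<omega>)"
    "\<And>\<omega>. \<omega> \<in> \<T> \<Longrightarrow> G1 \<omega> \<in> L2_on_surface (S \<omega>)" "\<And>\<omega>. \<omega> \<in> \<T> \<Longrightarrow> G2 \<omega> \<in> L2_on_surface (S \<omega>)"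
    "\<And>\<omega>. \<omega> \<in> \<T> \<Longrightarrow> surf_AE (S \<omega>) (\<lambda>x. G \<omega> x = G1 \<omega> x - G2 \<omega> x)"
  shows "bdry_ip \<Omega> \<T> \<Gamma> F G = bdry_ip \<Omega> \<T> \<Gamma> F G1 - bdry_ip \<Omega> \<T> \<Gamma> F G2"
  unfolding bdry_ip_def sum_subtractf[symmetric]
proof (rule sum.cong)
  fix \<omega> assume \<omega>: "\<omega> \<in> \<T>"
  have "S \<omega> \<in> sets borel" unfolding S_def using assms(2) by auto
  from surf_int_inner_diff_right[OF this assms(3-7)[OF \<omega>]]
  show "surf_int (\<Gamma> \<inter> bdry \<Omega> \<inter> bdry \<omega>) (\<lambda>x. F \<omega> x * G \<omega> x) =
      surf_int (\<Gamma> \<inter> bdry \<Omega> \<inter> bdry \<omega>) (\<lambda>x. F \<omega> x * G1 \<omega> x) - surf_int (\<Gamma> \<inter> bdry \<Omega> \<inter> bdry \<omega>) (\<lambda>x. F \<omega> x * G2 \<omega> x)"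
    by (simp add: S_def)
qed simp

text \<open>The data give \<open>m \<le> drag D i x \<le> M\<close> with \<open>m > 0\<close>.
  Mobility is the reciprocal of drag, hence the common bound \<open>max M (1 / m)\<close>.\<close>

lemma dpp_coefficients_bounded:
  assumes D: "dpp_data D" and i: "i \<in> {1, 2}"
  shows "\<exists>C. \<forall>\<omega>\<in>mesh D. \<forall>x\<in>\<omega>. \<bar>drag D i x\<bar> \<le> C \<and> \<bar>mobility D i x\<bar> \<le> C"
    and "\<omega> \<in> mesh D \<Longrightarrow> drag D i \<in> borel_measurable (lebesgue_on \<omega>)"
    and "\<omega> \<in> mesh D \<Longrightarrow> mobility D i \<in> borel_measurable (lebesgue_on \<omega>)"
proof -
  have mesh: "is_mesh (region D) (mesh D)" and region: "interior (closure (region D)) = region D"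
    and meas: "perm D i \<in> borel_measurable (lebesgue_on (region D))"
    using D i unfolding dpp_data_def by blast+
  \<comment> \<open>A mesh places its elements only in the closure of the region. Being open, they
    lie in the interior of that closure, which is the region itself.\<close>
  have sub: "\<omega> \<subseteq> region D" if \<omega>: "\<omega> \<in> mesh D" for \<omega>
  proof -
    have "\<omega> \<subseteq> closure (region D)"
      using mesh \<omega> closure_subset[of \<omega>] unfolding is_mesh_def by auto
    moreover have "open \<omega>"
      using is_mesh_bounded_open_elements[OF mesh] \<omega> by (simp add: bounded_open_elements_def)
    ultimately have "\<omega> \<subseteq> interior (closure (region D))"
      by (rule interior_maximal)
    then show ?thesis by (simp only: region)
  qed
  have "\<exists>m M. 0 < m \<and> (\<forall>x\<in>region D. m \<le> visc D / perm D i x \<and> visc D / perm D i x \<le> M)"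
    using D i unfolding dpp_data_def by blast
  then obtain m M where m: "0 < m" and bounds: "\<And>x. x \<in> region D \<Longrightarrow> m \<le> drag D i x \<and> drag D i x \<le> M"
    unfolding drag_def by blast
  have "\<bar>drag D i x\<bar> \<le> max M (1 / m) \<and> \<bar>mobility D i x\<bar> \<le> max M (1 / m)" if "x \<in> region D" for x
  proof -
    have mob: "mobility D i x = 1 / drag D i x"
      by (simp add: mobility_def drag_def)
    have "1 / drag D i x \<le> 1 / m"
      using bounds[OF that] m by (intro divide_left_mono) auto
    then show ?thesis
      unfolding mob using bounds[OF that] m by (auto simp: le_max_iff_disj)
  qed
  with sub show "\<exists>C. \<forall>\<omega>\<in>mesh D. \<forall>x\<in>\<omega>. \<bar>drag D i x\<bar> \<le> C \<and> \<bar>mobility D i x\<bar> \<le> C"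
    by blast
  assume "\<omega> \<in> mesh D"
  then have "perm D i \<in> borel_measurable (lebesgue_on \<omega>)"
    using measurable_restrict_mono[OF meas] sub by blast
  then show "drag D i \<in> borel_measurable (lebesgue_on \<omega>)" "mobility D i \<in> borel_measurable (lebesgue_on \<omega>)"
    by (simp_all add: drag_def[abs_def] mobility_def[abs_def])
qed

text \<open>Pressures are taken from \<open>broken_H1\<close>, one network at a time, because the
  condition in \<open>pres_space\<close> ties both networks together.\<close>

lemma B_net_diff_right:
  assumes D: "dpp_data D" and i: "i \<in> {1, 2}"
    and vel: "w \<in> vel_space (mesh D)" "u \<in> vel_space (mesh D)" "u' \<in> vel_space (mesh D)"
    and pres: "q \<in> broken_H1 (mesh D)" "p \<in> broken_H1 (mesh D)" "p' \<in> broken_H1 (mesh D)"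
  shows "B_net D i w q (\<lambda>x. u x - u' x) (\<lambda>x. p x - p' x) = B_net D i w q u p - B_net D i w q u' p'"
proof -
  define \<T> where "\<T> = mesh D"
  define \<kappa> where "\<kappa> = drag D i"
  define m where "m = mobility D i"
  note vel = vel[folded \<T>_def] and pres = pres[folded \<T>_def]
  have "is_mesh (region D) \<T>" and \<Gamma>: "bd_u D i \<in> sets borel"
    using D i unfolding dpp_data_def \<T>_def by blast+
  then have \<T>: "bounded_open_elements \<T>"
    by (intro is_mesh_bounded_open_elements)
  obtain C where C: "\<And>\<omega> x. \<omega> \<in> \<T> \<Longrightarrow> x \<in> \<omega> \<Longrightarrow> \<bar>\<kappa> x\<bar> \<le> C" "\<And>\<omega> x. \<omega> \<in> \<T> \<Longrightarrow> x \<in> \<omega> \<Longrightarrow> \<bar>m x\<bar> \<le> C"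
    using dpp_coefficients_bounded(1)[OF D i] unfolding \<T>_def \<kappa>_def m_def by blast
  have meas: "\<kappa> \<in> borel_measurable (lebesgue_on \<omega>)" "m \<in> borel_measurable (lebesgue_on \<omega>)" if "\<omega> \<in> \<T>" for \<omega>
    using dpp_coefficients_bounded(2,3)[OF D i] that unfolding \<T>_def \<kappa>_def m_def by blast+
  have scaled: "(\<lambda>x. \<kappa> x *\<^sub>R v x) \<in> L2 (lebesgue_on \<omega>)" "(\<lambda>x. m x *\<^sub>R v x) \<in> L2 (lebesgue_on \<omega>)"
    if "\<omega> \<in> \<T>" "v \<in> L2 (lebesgue_on \<omega>)" for \<omega> and v :: "'a \<Rightarrow> 'a"
    using that C by (auto intro!: L2_scaleR_bounded[where C = C] meas)
  have vel_diff: "(\<lambda>x. u x - u' x) \<in> vel_space \<T>" and pres_diff: "(\<lambda>x. p x - p' x) \<in> broken_H1 \<T>"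
    using vel_space_diff[OF \<T>] broken_H1_diff[OF \<T>] vel pres by auto
  note fields = vel pres vel_diff pres_diff
  have vel_L2: "v \<in> L2 (lebesgue_on \<omega>)" "wdiv \<omega> v \<in> L2 (lebesgue_on \<omega>)"
    if "\<omega> \<in> \<T>" "v \<in> vel_space \<T>" for \<omega> v
    using that wdiv_L2[of \<omega> v] by (auto simp: vel_space_def)
  have grad_L2: "grad \<omega> f \<in> L2 (lebesgue_on \<omega>)" if "\<omega> \<in> \<T>" "f \<in> broken_H1 \<T>" for \<omega> f
    using that grad_L2 by (auto simp: broken_H1_def)
  have grad_diff: "AE x in lebesgue_on \<omega>. grad \<omega> (\<lambda>x. p x - p' x) x = grad \<omega> p x - grad \<omega> p' x"
    if "\<omega> \<in> \<T>" for \<omega>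
    using that pres by (intro grad_diff element_open_bounded[OF \<T>]) (auto simp: broken_H1_def)
  have wdiv_diff: "AE x in lebesgue_on \<omega>. wdiv \<omega> (\<lambda>x. u x - u' x) x = wdiv \<omega> u x - wdiv \<omega> u' x"
    if "\<omega> \<in> \<T>" for \<omega>
    using that vel by (intro wdiv_diff element_open_bounded[OF \<T>]) (auto simp: vel_space_def)
  note L2s = vel_L2 grad_L2 scaled broken_H1_L2[OF \<T>] fields
  note edge_L2s = avg_L2[OF \<T>] jump_L2[OF \<T>] jump_vec_L2[OF \<T>] fields

  \<comment> \<open>From here on, each of the ten terms of \<open>B_net\<close> is split separately:
    square integrability of all factors, then the almost everywhere identity for the right
    one.\<close>
  have vol_u: "vol_ip \<T> (\<lambda>_. w) (\<lambda>_ x. \<kappa> x *\<^sub>R (u x - u' x)) =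
      vol_ip \<T> (\<lambda>_. w) (\<lambda>_ x. \<kappa> x *\<^sub>R u x) - vol_ip \<T> (\<lambda>_. w) (\<lambda>_ x. \<kappa> x *\<^sub>R u' x)"
    by (rule vol_ip_diff_right) (intro L2s AE_I2; simp add: scaleR_diff_right)+
  have vol_p: "vol_ip \<T> (\<lambda>\<omega>. wdiv \<omega> w) (\<lambda>_ x. p x - p' x) =
      vol_ip \<T> (\<lambda>\<omega>. wdiv \<omega> w) (\<lambda>_. p) - vol_ip \<T> (\<lambda>\<omega>. wdiv \<omega> w) (\<lambda>_. p')"
    by (rule vol_ip_diff_right) (intro L2s AE_I2; simp)+
  have vol_div: "vol_ip \<T> (\<lambda>_. q) (\<lambda>\<omega>. wdiv \<omega> (\<lambda>x. u x - u' x)) =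
      vol_ip \<T> (\<lambda>_. q) (\<lambda>\<omega>. wdiv \<omega> u) - vol_ip \<T> (\<lambda>_. q) (\<lambda>\<omega>. wdiv \<omega> u')"
    by (rule vol_ip_diff_right) (intro L2s wdiv_diff; assumption)+
  have vol_stab: "vol_ip \<T> (\<lambda>\<omega> x. \<kappa> x *\<^sub>R w x - grad \<omega> q x)
        (\<lambda>\<omega> x. m x *\<^sub>R (\<kappa> x *\<^sub>R (u x - u' x) + grad \<omega> (\<lambda>x. p x - p' x) x)) =
      vol_ip \<T> (\<lambda>\<omega> x. \<kappa> x *\<^sub>R w x - grad \<omega> q x) (\<lambda>\<omega> x. m x *\<^sub>R (\<kappa> x *\<^sub>R u x + grad \<omega> p x)) -
      vol_ip \<T> (\<lambda>\<omega> x. \<kappa> x *\<^sub>R w x - grad \<omega> q x) (\<lambda>\<omega> x. m x *\<^sub>R (\<kappa> x *\<^sub>R u' x + grad \<omega> p' x))"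
  proof (rule vol_ip_diff_right)
    fix \<omega> assume \<omega>: "\<omega> \<in> \<T>"
    show "AE x in lebesgue_on \<omega>. m x *\<^sub>R (\<kappa> x *\<^sub>R (u x - u' x) + grad \<omega> (\<lambda>x. p x - p' x) x) =
        m x *\<^sub>R (\<kappa> x *\<^sub>R u x + grad \<omega> p x) - m x *\<^sub>R (\<kappa> x *\<^sub>R u' x + grad \<omega> p' x)"
      using grad_diff[OF \<omega>] by eventually_elim (simp add: scaleR_diff_right scaleR_add_right)
  qed (intro L2_diff L2_add L2s; assumption)+

  have edge_avg: "edge_ip \<T> (\<lambda>e. jump_vec e w) (\<lambda>e. avg e (\<lambda>x. p x - p' x)) =
      edge_ip \<T> (\<lambda>e. jump_vec e w) (\<lambda>e. avg e p) - edge_ip \<T> (\<lambda>e. jump_vec e w) (\<lambda>e. avg e p')"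
    by (rule edge_ip_diff_right) (intro edge_L2s avg_diff[OF \<T>]; assumption)+
  have edge_jump: "edge_ip \<T> (\<lambda>e. avg e q) (\<lambda>e. jump_vec e (\<lambda>x. u x - u' x)) =
      edge_ip \<T> (\<lambda>e. avg e q) (\<lambda>e. jump_vec e u) - edge_ip \<T> (\<lambda>e. avg e q) (\<lambda>e. jump_vec e u')"
    by (rule edge_ip_diff_right) (intro edge_L2s jump_vec_diff[OF \<T>]; assumption)+
  \<comment> \<open>\<open>c\<close> collects the constants of the penalty terms, and the type of
    \<open>v\<close> is left general since \<open>jump_vec\<close> is scalar-valued and
    \<open>jump\<close> vector-valued.\<close>
  have weighted: "(\<lambda>x. (c * avg e a x) *\<^sub>R v x) \<in> L2_on_surface (edge_pts e)"
    if e: "e \<in> int_edges \<T>" and a: "a = \<kappa> \<or> a = m" and v: "v \<in> L2_on_surface (edge_pts e)"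
    for e a c and v :: "'a \<Rightarrow> 'b::euclidean_space"
  proof -
    have "\<forall>\<omega>\<in>\<T>. a \<in> borel_measurable (lebesgue_on \<omega>)" "\<forall>\<omega>\<in>\<T>. \<forall>x\<in>\<omega>. \<bar>a x\<bar> \<le> C"
      using a meas C by auto
    note avg_a = avg_bounded_coefficient[OF \<T> e this]
    obtain K where "\<And>x. \<bar>avg e a x\<bar> \<le> K" using avg_a(2) by blast
    then have "\<And>x. \<bar>c * avg e a x\<bar> \<le> \<bar>c\<bar> * K"
      by (simp add: abs_mult mult_left_mono)
    then show ?thesis
      using avg_a(1) v
      by (intro L2_on_surface_scaleR_bounded[where C = "\<bar>c\<bar> * K"] measurable_restrict_space1) auto
  qed
  have edge_u: "edge_ip \<T> (\<lambda>e x. eta_u D * edge_size e * avg e \<kappa> x * jump_vec e w x) (\<lambda>e. jump_vec e (\<lambda>x. u x - u' x)) =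
      edge_ip \<T> (\<lambda>e x. eta_u D * edge_size e * avg e \<kappa> x * jump_vec e w x) (\<lambda>e. jump_vec e u) -
      edge_ip \<T> (\<lambda>e x. eta_u D * edge_size e * avg e \<kappa> x * jump_vec e w x) (\<lambda>e. jump_vec e u')"
  proof (rule edge_ip_diff_right)
    fix e assume e: "e \<in> int_edges \<T>"
    show "(\<lambda>x. eta_u D * edge_size e * avg e \<kappa> x * jump_vec e w x) \<in> L2_on_surface (edge_pts e)"
      using weighted[OF e _ jump_vec_L2[OF \<T> vel(1) e], of \<kappa> "eta_u D * edge_size e"] by simp
  qed (intro edge_L2s jump_vec_diff[OF \<T>]; assumption)+
  have edge_p: "edge_ip \<T> (\<lambda>e x. (eta_p D / edge_size e * avg e m x) *\<^sub>R jump e q x) (\<lambda>e. jump e (\<lambda>x. p x - p' x)) =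
      edge_ip \<T> (\<lambda>e x. (eta_p D / edge_size e * avg e m x) *\<^sub>R jump e q x) (\<lambda>e. jump e p) -
      edge_ip \<T> (\<lambda>e x. (eta_p D / edge_size e * avg e m x) *\<^sub>R jump e q x) (\<lambda>e. jump e p')"
    by (rule edge_ip_diff_right) (intro weighted edge_L2s jump_diff[OF \<T>] disjI2 refl; assumption)+

  have S: "bd_u D i \<inter> bdry (region D) \<inter> bdry \<omega> \<in> sets borel" for \<omega>
    using \<Gamma> by auto
  have bdry_p: "bdry_ip (region D) \<T> (bd_u D i) (\<lambda>\<omega> x. tr_vec \<omega> w x \<bullet> normal (region D) x) (\<lambda>\<omega>. tr \<omega> (\<lambda>x. p x - p' x)) =
      bdry_ip (region D) \<T> (bd_u D i) (\<lambda>\<omega> x. tr_vec \<omega> w x \<bullet> normal (region D) x) (\<lambda>\<omega>. tr \<omega> p) -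
      bdry_ip (region D) \<T> (bd_u D i) (\<lambda>\<omega> x. tr_vec \<omega> w x \<bullet> normal (region D) x) (\<lambda>\<omega>. tr \<omega> p')"
    by (rule bdry_ip_diff_right[OF \<Gamma>])
       (intro normal_trace_L2[OF \<T>] tr_L2[OF \<T>] tr_diff[OF \<T>] S fields; (assumption | blast))+
  have bdry_u: "bdry_ip (region D) \<T> (bd_u D i) (\<lambda>\<omega>. tr \<omega> q) (\<lambda>\<omega> x. tr_vec \<omega> (\<lambda>x. u x - u' x) x \<bullet> normal (region D) x) =
      bdry_ip (region D) \<T> (bd_u D i) (\<lambda>\<omega>. tr \<omega> q) (\<lambda>\<omega> x. tr_vec \<omega> u x \<bullet> normal (region D) x) -
      bdry_ip (region D) \<T> (bd_u D i) (\<lambda>\<omega>. tr \<omega> q) (\<lambda>\<omega> x. tr_vec \<omega> u' x \<bullet> normal (region D) x)"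
  proof (rule bdry_ip_diff_right[OF \<Gamma>])
    fix \<omega> assume \<omega>: "\<omega> \<in> \<T>"
    have "surf_AE (bd_u D i \<inter> bdry (region D) \<inter> bdry \<omega>)
        (\<lambda>x. tr_vec \<omega> (\<lambda>x. u x - u' x) x = tr_vec \<omega> u x - tr_vec \<omega> u' x)"
      by (intro tr_vec_diff[OF \<T>] fields \<omega>) blast
    then show "surf_AE (bd_u D i \<inter> bdry (region D) \<inter> bdry \<omega>)
        (\<lambda>x. tr_vec \<omega> (\<lambda>x. u x - u' x) x \<bullet> normal (region D) x =
          tr_vec \<omega> u x \<bullet> normal (region D) x - tr_vec \<omega> u' x \<bullet> normal (region D) x)"
      by (rule surf_AE_imp) (simp add: inner_diff_left)
  qed (intro normal_trace_L2[OF \<T>] tr_L2[OF \<T>] S fields; (assumption | blast))+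

  show ?thesis
    unfolding B_net_def Let_def \<T>_def[symmetric] \<kappa>_def[symmetric] m_def[symmetric]
      vol_u vol_p vol_div vol_stab edge_avg edge_jump edge_u edge_p bdry_p bdry_u
    by (simp add: algebra_simps)
qed

text \<open>Membership in \<open>U_space\<close> is required of \<open>W\<close>, \<open>U\<close>
  and \<open>U'\<close> but not claimed for \<open>U - U'\<close>; the form is evaluated there by
  its formula.\<close>

lemma B_stab_diff_right:
  assumes D: "dpp_data D" and W: "W \<in> U_space D" and U: "U \<in> U_space D" "U' \<in> U_space D"
  shows "B_stab D W (U - U') = B_stab D W U - B_stab D W U'"
proof -
  obtain w1 w2 q1 q2 u1 u2 p1 p2 u1' u2' p1' p2' where eq: "W = (w1, w2, q1, q2)" "U = (u1, u2, p1, p2)" "U' = (u1', u2', p1', p2')"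
    by (metis prod_cases4)
  have "is_mesh (region D) (mesh D)"
    using D unfolding dpp_data_def by blast
  then have \<T>: "bounded_open_elements (mesh D)"
    by (rule is_mesh_bounded_open_elements)
  have vel: "w1 \<in> vel_space (mesh D)" "w2 \<in> vel_space (mesh D)" "u1 \<in> vel_space (mesh D)" "u2 \<in> vel_space (mesh D)"
      "u1' \<in> vel_space (mesh D)" "u2' \<in> vel_space (mesh D)"
    and pres: "q1 \<in> broken_H1 (mesh D)" "q2 \<in> broken_H1 (mesh D)" "p1 \<in> broken_H1 (mesh D)" "p2 \<in> broken_H1 (mesh D)"
      "p1' \<in> broken_H1 (mesh D)" "p2' \<in> broken_H1 (mesh D)"
    using W U by (auto simp: eq U_space_def pres_space_def broken_H1_def)
  define c where "c = transfer_coeff D / visc D"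
  have scaled: "(\<lambda>x. c * (f x - g x)) \<in> L2 (lebesgue_on \<omega>)"
    if "\<omega> \<in> mesh D" "f \<in> broken_H1 (mesh D)" "g \<in> broken_H1 (mesh D)" for \<omega> f g
    using L2_scaleR_bounded[of "\<lambda>_. c" "lebesgue_on \<omega>" "\<bar>c\<bar>" "\<lambda>x. f x - g x"]
      L2_diff[OF broken_H1_L2[OF \<T> that(2,1)] broken_H1_L2[OF \<T> that(3,1)]] by simp
  \<comment> \<open>The coupling term mixes the networks: the pressure differences within each
    network are regrouped into the differences between networks for \<open>U\<close> and for
    \<open>U'\<close>.\<close>
  have "vol_ip (mesh D) (\<lambda>_ x. q1 x - q2 x) (\<lambda>_ x. c * ((p1 x - p1' x) - (p2 x - p2' x))) =
      vol_ip (mesh D) (\<lambda>_ x. q1 x - q2 x) (\<lambda>_ x. c * (p1 x - p2 x)) -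
      vol_ip (mesh D) (\<lambda>_ x. q1 x - q2 x) (\<lambda>_ x. c * (p1' x - p2' x))"
  proof (rule vol_ip_diff_right)
    fix \<omega> assume \<omega>: "\<omega> \<in> mesh D"
    show "(\<lambda>x. q1 x - q2 x) \<in> L2 (lebesgue_on \<omega>)"
      by (intro L2_diff broken_H1_L2[OF \<T>] pres \<omega>)
    show "(\<lambda>x. c * ((p1 x - p1' x) - (p2 x - p2' x))) \<in> L2 (lebesgue_on \<omega>)"
      by (intro scaled broken_H1_diff[OF \<T>] pres \<omega>)
    show "(\<lambda>x. c * (p1 x - p2 x)) \<in> L2 (lebesgue_on \<omega>)" "(\<lambda>x. c * (p1' x - p2' x)) \<in> L2 (lebesgue_on \<omega>)"
      by (intro scaled pres \<omega>)+
    show "AE x in lebesgue_on \<omega>. c * ((p1 x - p1' x) - (p2 x - p2' x)) = c * (p1 x - p2 x) - c * (p1' x - p2' x)"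
      by (intro AE_I2) (simp add: algebra_simps)
  qed
  then show ?thesis
    using B_net_diff_right[OF D _ vel(1,3,5) pres(1,3,5), of 1]
      B_net_diff_right[OF D _ vel(2,4,6) pres(2,4,6), of 2]
    by (simp add: eq fun_diff_def c_def)
qed

theorem theorem4p5:
  fixes D :: "'a::euclidean_space dpp" and k l :: nat and U Uh E :: "'a fields"
  assumes "dpp_data D"
    and "U \<in> U_space D"
    and "\<forall>W\<in>U_space D. B_stab D W U = L_stab D W"
    and "Uh \<in> U_space_h D k l"
    and "\<forall>Wh\<in>U_space_h D k l. B_stab D Wh Uh = L_stab D Wh"
    and "E = Uh - U"
  shows "U_space_h D k l \<subseteq> U_space D \<and> (\<forall>Wh\<in>U_space_h D k l. B_stab D Wh E = 0)"
proof -
  \<comment> \<open>Conformity lets a discrete test field be inserted into the continuous problem as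
    well.\<close>
  have sub: "U_space_h D k l \<subseteq> U_space D"
    by (auto simp: U_space_h_def U_space_def vel_space_h_def pres_space_h_def)
  have "B_stab D Wh E = 0" if Wh: "Wh \<in> U_space_h D k l" for Wh
  proof -
    have "Wh \<in> U_space D" "Uh \<in> U_space D"
      using sub Wh assms(4) by blast+
    then have "B_stab D Wh E = B_stab D Wh Uh - B_stab D Wh U"
      unfolding assms(6) by (intro B_stab_diff_right assms)
    then show ?thesis
      using assms(3,5) Wh \<open>Wh \<in> U_space D\<close> by simp
  qed
  with sub show ?thesis by blast
qed

end
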